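(* Let $W\in L^1((0,1)^2)$ be a graphon with $W(x,y)=W(y,x)\ge0$ for all $(x,y)\in(0,1)^2$ and $\int_0^1W(x,y)\,dy\le1$ for a.e. $x\in(0,1)$. Let $T>0$, $p\in[1,\infty]$ and $u_0\in L^p((0,1))$. Then there exists a unique solution $u\in C^1([0,T];L^p((0,1)))$ of the graphon diffusion equation $\partial_tu=\mathcal{L}^Wu$ with initial condition $u(x,0)=u_0(x)$. The solution is given by $u(\cdot,t)=e^{t\mathcal{L}^W}u_0$ for all $t\ge0$. Moreover, $$\|e^{t\mathcal{L}^W}u_0\|_p\le\|u_0\|_p\qquad\text{for all }t\ge0.$$
   Context: The graphon diffusion operator is $\mathcal{L}^W u(x)=\int_0^1 W(x,y)\,(u(y)-u(x))\,dy$; under the stated hypotheses on $W$ it is a bounded linear operator on $L^p((0,1))$ for every $p\in[1,\infty]$, and $\{e^{t\mathcal{L}^W}\}_{t\ge0}$ denotes the uniformly continuous semigroup on $L^p((0,1))$ that it generates. Solutions are understood as identities in $L^p((0,1))$ for $t\in[0,T]$. *)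

theory Defs
  imports "HOL-Analysis.Analysis" "HOL-Probability.Essential_Supremum"
begin

text \<open>
  Elements of \<open>L\<^sup>p((0,1))\<close> are represented by Lebesgue measurable functions
  \<open>real \<Rightarrow> real\<close>; equality in \<open>L\<^sup>p((0,1))\<close> is equality almost everywhere on \<open>(0,1)\<close>.
  Values outside of \<open>(0,1)\<close> play no role.
\<close>

abbreviation unit_leb :: "real measure" where
  "unit_leb \<equiv> lebesgue_on {0<..<1}"

definition ae_eq :: "(real \<Rightarrow> real) \<Rightarrow> (real \<Rightarrow> real) \<Rightarrow> bool" where
  "ae_eq f g \<longleftrightarrow> (AE x in unit_leb. f x = g x)"

definition Lp :: "ereal \<Rightarrow> (real \<Rightarrow> real) set" where
  "Lp p = {f \<in> borel_measurable unit_leb.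
     if p = \<infinity> then esssup unit_leb (\<lambda>x. ereal \<bar>f x\<bar>) < \<infinity>
     else integrable unit_leb (\<lambda>x. \<bar>f x\<bar> powr real_of_ereal p)}"

text \<open>The norm is only meaningful for members of \<open>Lp p\<close>; elsewhere it is a default value.\<close>

definition Lp_norm :: "ereal \<Rightarrow> (real \<Rightarrow> real) \<Rightarrow> real" where
  "Lp_norm p f =
     (if p = \<infinity> then real_of_ereal (esssup unit_leb (\<lambda>x. ereal \<bar>f x\<bar>))
      else (LINT x|unit_leb. \<bar>f x\<bar> powr real_of_ereal p) powr (1 / real_of_ereal p))"

subsection \<open>Calculus for curves in \<open>L\<^sup>p((0,1))\<close>\<close>

definition Lp_tendsto ::
  "ereal \<Rightarrow> (real \<Rightarrow> real \<Rightarrow> real) \<Rightarrow> (real \<Rightarrow> real) \<Rightarrow> real filter \<Rightarrow> bool" where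
  "Lp_tendsto p u f F \<longleftrightarrow> ((\<lambda>s. Lp_norm p (\<lambda>x. u s x - f x)) \<longlongrightarrow> 0) F"

definition Lp_continuous_on :: "ereal \<Rightarrow> real set \<Rightarrow> (real \<Rightarrow> real \<Rightarrow> real) \<Rightarrow> bool" where
  "Lp_continuous_on p J u \<longleftrightarrow>
     (\<forall>t\<in>J. u t \<in> Lp p \<and> Lp_tendsto p u (u t) (at t within J))"

definition Lp_has_derivative_on ::
  "ereal \<Rightarrow> real set \<Rightarrow> (real \<Rightarrow> real \<Rightarrow> real) \<Rightarrow> (real \<Rightarrow> real \<Rightarrow> real) \<Rightarrow> bool" where
  "Lp_has_derivative_on p J u u' \<longleftrightarrow>
     (\<forall>t\<in>J. u t \<in> Lp p \<and> u' t \<in> Lp p \<and>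
        Lp_tendsto p (\<lambda>s x. (u s x - u t x) / (s - t)) (u' t) (at t within J))"

text \<open>\<open>u \<in> C\<^sup>1(J; L\<^sup>p((0,1)))\<close> with derivative \<open>u'\<close>, one-sided at end points of \<open>J\<close>.\<close>

definition Lp_C1_on ::
  "ereal \<Rightarrow> real set \<Rightarrow> (real \<Rightarrow> real \<Rightarrow> real) \<Rightarrow> (real \<Rightarrow> real \<Rightarrow> real) \<Rightarrow> bool" where
  "Lp_C1_on p J u u' \<longleftrightarrow> Lp_has_derivative_on p J u u' \<and> Lp_continuous_on p J u'"

subsection \<open>Uniformly continuous semigroups on \<open>L\<^sup>p((0,1))\<close>\<close>

text \<open>
  Linearity is required up to null sets. Together with boundedness this makes the operator
  respect almost everywhere equality, so that it is an operator on \<open>L\<^sup>p((0,1))\<close>.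
\<close>

definition Lp_bounded_linear ::
  "ereal \<Rightarrow> ((real \<Rightarrow> real) \<Rightarrow> (real \<Rightarrow> real)) \<Rightarrow> bool" where
  "Lp_bounded_linear p A \<longleftrightarrow>
     (\<forall>f\<in>Lp p. A f \<in> Lp p) \<and>
     (\<forall>f\<in>Lp p. \<forall>g\<in>Lp p. ae_eq (A (\<lambda>x. f x + g x)) (\<lambda>x. A f x + A g x)) \<and>
     (\<forall>f\<in>Lp p. \<forall>c. ae_eq (A (\<lambda>x. c * f x)) (\<lambda>x. c * A f x)) \<and>
     (\<exists>C. \<forall>f\<in>Lp p. Lp_norm p (A f) \<le> C * Lp_norm p f)"

definition Lp_opnorm :: "ereal \<Rightarrow> ((real \<Rightarrow> real) \<Rightarrow> (real \<Rightarrow> real)) \<Rightarrow> real" where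
  "Lp_opnorm p A = (SUP f\<in>{f \<in> Lp p. Lp_norm p f \<le> 1}. Lp_norm p (A f))"

definition uniformly_continuous_semigroup ::
  "ereal \<Rightarrow> (real \<Rightarrow> (real \<Rightarrow> real) \<Rightarrow> (real \<Rightarrow> real)) \<Rightarrow> bool" where
  "uniformly_continuous_semigroup p S \<longleftrightarrow>
     (\<forall>t\<ge>0. Lp_bounded_linear p (S t)) \<and>
     (\<forall>f\<in>Lp p. ae_eq (S 0 f) f) \<and>
     (\<forall>s\<ge>0. \<forall>t\<ge>0. \<forall>f\<in>Lp p. ae_eq (S (s + t) f) (S s (S t f))) \<and>
     ((\<lambda>t. Lp_opnorm p (\<lambda>f x. S t f x - f x)) \<longlongrightarrow> 0) (at_right 0)"

text \<open>
  The generator is everywhere defined on \<open>L\<^sup>p((0,1))\<close>, as is always the case for uniformly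
  continuous semigroups.
\<close>

definition generated_by ::
  "ereal \<Rightarrow> (real \<Rightarrow> (real \<Rightarrow> real) \<Rightarrow> (real \<Rightarrow> real)) \<Rightarrow>
   ((real \<Rightarrow> real) \<Rightarrow> (real \<Rightarrow> real)) \<Rightarrow> bool" where
  "generated_by p S A \<longleftrightarrow>
     (\<forall>f\<in>Lp p. A f \<in> Lp p \<and>
        Lp_tendsto p (\<lambda>t x. (S t f x - f x) / t) (A f) (at_right 0))"

text \<open>
  \<open>e\<^sup>t\<^sup>A\<close> as the uniformly continuous semigroup generated by \<open>A\<close>. Such a semigroup is unique in
  \<open>L\<^sup>p((0,1))\<close>; the choice only concerns representatives.
\<close>

definition exp_semigroup ::
  "ereal \<Rightarrow> ((real \<Rightarrow> real) \<Rightarrow> (real \<Rightarrow> real)) \<Rightarrow> real \<Rightarrow> (real \<Rightarrow> real) \<Rightarrow> (real \<Rightarrow> real)" where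
  "exp_semigroup p A = (SOME S. uniformly_continuous_semigroup p S \<and> generated_by p S A)"

subsection \<open>Graphon diffusion\<close>

text \<open>
  For a symmetric nonnegative integrable \<open>W\<close> with degrees at most 1 and \<open>u \<in> L\<^sup>p((0,1))\<close> the integrand is integrable for almost every
  \<open>x\<close>; on the remaining null set the integral takes its default value 0.
\<close>

definition graphon_diffusion ::
  "(real \<Rightarrow> real \<Rightarrow> real) \<Rightarrow> (real \<Rightarrow> real) \<Rightarrow> (real \<Rightarrow> real)" where
  "graphon_diffusion W u = (\<lambda>x. LINT y|unit_leb. W x y * (u y - u x))"

definition diffusion_solution ::
  "ereal \<Rightarrow> (real \<Rightarrow> real \<Rightarrow> real) \<Rightarrow> real \<Rightarrow> (real \<Rightarrow> real) \<Rightarrow> (real \<Rightarrow> real \<Rightarrow> real) \<Rightarrow> bool" where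
  "diffusion_solution p W T u\<^sub>0 u \<longleftrightarrow>
     (\<exists>u'. Lp_C1_on p {0..T} u u' \<and>
        (\<forall>t\<in>{0..T}. ae_eq (u' t) (graphon_diffusion W (u t)))) \<and>
     ae_eq (u 0) u\<^sub>0"

end

theory Submission
  imports Defs "HOL-Probability.Probability_Measure"
begin

text \<open>
  Put \<open>B = \<L> + I\<close>. Since all degrees are at most 1, \<open>B\<close> is a Markov operator, and by symmetry of \<open>W\<close> it
  leaves Lebesgue measure invariant; Jensen's inequality and Tonelli's theorem then show that \<open>B\<close> is
  a contraction on every \<open>L\<^sup>p\<close>. Hence \<open>e\<^bsup>t\<L>\<^esup> = e\<^bsup>-t\<^esup> e\<^bsup>tB\<^esup> = \<Sum>\<^sub>n e\<^bsup>-t\<^esup> t\<^sup>n/n! B\<^sup>n\<close> is an average of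
  contractions with Poisson weights. Uniqueness of solutions takes place in \<open>L\<^sup>1 \<supseteq> L\<^sup>p\<close>, and it also
  identifies every uniformly continuous semigroup generated by \<open>\<L>\<close>, because the orbits of such a
  semigroup are solutions.
\<close>

subsection \<open>The spaces \<open>L\<^sup>p\<close>\<close>

text \<open>The operator \<L> itself has norm at most 2, so its own exponential series only yields
  the growth e^(2t). Poisson weights are nonnegative with sum 1 and lose nothing, which is why
  \<open>B\<close> is exponentiated instead. Functions are representatives, and identities between
  operators hold only up to null sets; a bounded operator respects them because it maps radius 0 to
  radius 0. Curves in L^p are never integrated: the uniqueness proof pairs a curve with a bounded
  function and applies the real mean value theorem. Uniqueness also replaces algebra: the semigroup
  law of \<open>heat\<close> compares two solutions with the same initial value, without multiplying
  series. \<open>exp_semigroup\<close> is a choice, so nothing is known of it beyond its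
  specification. \<open>heat\<close> shows that the specification can be met, and the norm bound,
  proved for \<open>heat\<close>, is carried over along the orbit of the initial value.\<close>

lemma emeasure_unit_leb: "emeasure unit_leb {0<..<1} = 1"
  by (simp add: emeasure_restrict_space)

lemma prob_space_unit_leb: "prob_space unit_leb"
  by (rule prob_spaceI) (simp add: emeasure_unit_leb)

interpretation unit_leb: prob_space unit_leb
  by (rule prob_space_unit_leb)

lemma ae_eq_sym: "ae_eq f g \<Longrightarrow> ae_eq g f"
  unfolding ae_eq_def by (auto elim: eventually_mono)

lemma ae_eq_trans [trans]: "ae_eq f g \<Longrightarrow> ae_eq g h \<Longrightarrow> ae_eq f h"
  unfolding ae_eq_def by (auto elim: eventually_elim2)

text \<open>This is completeness of Lebesgue measure; extension by zero carries the claim from the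
  interval to the whole line.\<close>

lemma borel_measurable_ae_eq:
  assumes f: "f \<in> borel_measurable unit_leb" and eq: "ae_eq f g"
  shows "g \<in> borel_measurable unit_leb"
proof -
  have f': "(\<lambda>x. indicator {0<..<1} x *\<^sub>R f x) \<in> borel_measurable lebesgue"
    using f by (subst (asm) borel_measurable_restrict_space_iff) auto
  have "AE x in lebesgue. x \<in> {0<..<1} \<longrightarrow> f x = g x"
    using eq unfolding ae_eq_def by (subst (asm) AE_restrict_space_iff) auto
  then have eq': "AE x in lebesgue.
      indicator {0<..<1} x *\<^sub>R f x = indicator {0<..<1} x *\<^sub>R g x"
    by (rule eventually_mono) (auto simp: indicator_def)
  have "(\<lambda>x. indicator {0<..<1} x *\<^sub>R g x) \<in> borel_measurable lebesgue"
    using f' eq' by (rule borel_measurable_AE)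
  then show ?thesis
    by (subst borel_measurable_restrict_space_iff) auto
qed

lemma Lp_measurable: "f \<in> Lp p \<Longrightarrow> f \<in> borel_measurable unit_leb"
  by (simp add: Lp_def)

text \<open>Positive total measure matters: over a null space the essential supremum of 0 would be
  -\<infinity>.\<close>

lemma esssup_abs_nonneg: "0 \<le> esssup unit_leb (\<lambda>x. ereal \<bar>f x\<bar>)"
proof -
  have "esssup unit_leb (\<lambda>x. 0::ereal) \<le> esssup unit_leb (\<lambda>x. ereal \<bar>f x\<bar>)"
    by (rule esssup_mono) auto
  then show ?thesis
    by (subst (asm) esssup_const) (auto simp: emeasure_unit_leb)
qed

lemma Lp_norm_nonneg: "0 \<le> Lp_norm p f"
  using esssup_abs_nonneg[of f] by (auto simp: Lp_norm_def real_of_ereal_pos)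

text \<open>\<open>Lp_norm\<close> is a default value off \<open>Lp\<close>, so a norm bound alone
  says nothing. A ball joins the bound to membership in the space, and most estimates below are
  stated in this form.\<close>

definition Lp_cball :: "ereal \<Rightarrow> real \<Rightarrow> (real \<Rightarrow> real) set" where
  "Lp_cball p C = {f \<in> Lp p. Lp_norm p f \<le> C}"

lemma Lp_cball_norm: "f \<in> Lp p \<Longrightarrow> f \<in> Lp_cball p (Lp_norm p f)"
  by (simp add: Lp_cball_def)

lemma Lp_cballD:
  assumes "f \<in> Lp_cball p C"
  shows "f \<in> Lp p" "Lp_norm p f \<le> C" "0 \<le> C" "f \<in> borel_measurable unit_leb"
  using assms Lp_norm_nonneg[of p f] by (auto simp: Lp_cball_def Lp_def)

lemma Lp_cball_mono: "f \<in> Lp_cball p C \<Longrightarrow> C \<le> D \<Longrightarrow> f \<in> Lp_cball p D"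
  by (auto simp: Lp_cball_def)

lemma Lp_cball_infinity:
  assumes "0 \<le> C"
  shows "f \<in> Lp_cball \<infinity> C \<longleftrightarrow>
    f \<in> borel_measurable unit_leb \<and> (AE x in unit_leb. \<bar>f x\<bar> \<le> C)"
proof (intro iffI conjI)
  let ?E = "esssup unit_leb (\<lambda>x. ereal \<bar>f x\<bar>)"
  assume f: "f \<in> Lp_cball \<infinity> C"
  then show "f \<in> borel_measurable unit_leb" by (rule Lp_cballD)
  have "?E < \<infinity>" "real_of_ereal ?E \<le> C"
    using f by (auto simp: Lp_cball_def Lp_def Lp_norm_def)
  with esssup_abs_nonneg[of f] have le: "?E \<le> ereal C"
    by (cases ?E) auto
  show "AE x in unit_leb. \<bar>f x\<bar> \<le> C"
    using esssup_AE[of "\<lambda>x. ereal \<bar>f x\<bar>" unit_leb]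
  proof eventually_elim
    case (elim x)
    with le have "ereal \<bar>f x\<bar> \<le> ereal C" by (rule order_trans[rotated])
    then show ?case by simp
  qed
next
  let ?E = "esssup unit_leb (\<lambda>x. ereal \<bar>f x\<bar>)"
  assume f: "f \<in> borel_measurable unit_leb \<and> (AE x in unit_leb. \<bar>f x\<bar> \<le> C)"
  then have "?E \<le> ereal C" by (intro esssup_I) auto
  with esssup_abs_nonneg[of f] f show "f \<in> Lp_cball \<infinity> C"
    by (cases ?E) (auto simp: Lp_cball_def Lp_def Lp_norm_def)
qed

text \<open>A finite nonnegative integral already contains integrability. In this form membership
  can be read off from Tonelli, Fatou or monotonicity.\<close>

lemma Lp_cball_real:
  assumes r: "1 \<le> r" and C: "0 \<le> C"
  shows "f \<in> Lp_cball (ereal r) C \<longleftrightarrow> f \<in> borel_measurable unit_leb \<and>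
    (\<integral>\<^sup>+x. ennreal (\<bar>f x\<bar> powr r) \<partial>unit_leb) \<le> ennreal (C powr r)"
proof (cases "f \<in> borel_measurable unit_leb \<and> integrable unit_leb (\<lambda>x. \<bar>f x\<bar> powr r)")
  case True
  let ?I = "LINT x|unit_leb. \<bar>f x\<bar> powr r"
  have I: "0 \<le> ?I" by simp
  have "?I powr (1 / r) \<le> C \<longleftrightarrow> ?I \<le> C powr r"
  proof
    assume "?I powr (1 / r) \<le> C"
    then have "(?I powr (1 / r)) powr r \<le> C powr r"
      using r by (intro powr_mono2) auto
    then show "?I \<le> C powr r" using r I by (simp add: powr_powr)
  next
    assume "?I \<le> C powr r"
    then have "?I powr (1 / r) \<le> (C powr r) powr (1 / r)"
      using r I by (intro powr_mono2) auto
    then show "?I powr (1 / r) \<le> C" using r C by (simp add: powr_powr)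
  qed
  moreover have "(\<integral>\<^sup>+x. ennreal (\<bar>f x\<bar> powr r) \<partial>unit_leb) = ennreal ?I"
    using True by (intro nn_integral_eq_integral) auto
  ultimately show ?thesis
    using True by (simp add: Lp_cball_def Lp_def Lp_norm_def)
next
  case False
  have "integrable unit_leb (\<lambda>x. \<bar>f x\<bar> powr r)"
    if f: "f \<in> borel_measurable unit_leb"
      and le: "(\<integral>\<^sup>+x. ennreal (\<bar>f x\<bar> powr r) \<partial>unit_leb) \<le> ennreal (C powr r)"
  proof (rule integrableI_bounded)
    show "(\<lambda>x. \<bar>f x\<bar> powr r) \<in> borel_measurable unit_leb" using f by simp
    show "(\<integral>\<^sup>+x. ennreal (norm (\<bar>f x\<bar> powr r)) \<partial>unit_leb) < \<infinity>"
      using le_less_trans[OF le ennreal_less_top] by simp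
  qed
  with False show ?thesis
    by (auto simp: Lp_cball_def Lp_def)
qed

lemma Lp_cball_dominated:
  assumes p: "1 \<le> p" and f: "f \<in> Lp_cball p C"
    and g: "g \<in> borel_measurable unit_leb" and le: "AE x in unit_leb. \<bar>g x\<bar> \<le> \<bar>f x\<bar>"
  shows "g \<in> Lp_cball p C"
proof (cases p)
  case (real r)
  with p have r: "1 \<le> r" by simp
  have C: "0 \<le> C" using f by (rule Lp_cballD)
  have "(\<integral>\<^sup>+x. ennreal (\<bar>g x\<bar> powr r) \<partial>unit_leb) \<le> (\<integral>\<^sup>+x. ennreal (\<bar>f x\<bar> powr r) \<partial>unit_leb)"
    using le r by (intro nn_integral_mono_AE) (auto elim!: eventually_mono intro!: ennreal_leI powr_mono2)
  with f g show ?thesis unfolding real using r C by (auto simp: Lp_cball_real)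
next
  case PInf
  have C: "0 \<le> C" using f by (rule Lp_cballD)
  with f g le show ?thesis unfolding PInf
    by (auto simp: Lp_cball_infinity elim: eventually_elim2)
qed (use p in auto)

lemma Lp_cball_ae_eq:
  assumes "1 \<le> p" "f \<in> Lp_cball p C" "ae_eq f g"
  shows "g \<in> Lp_cball p C"
proof (rule Lp_cball_dominated[OF assms(1,2)])
  show "g \<in> borel_measurable unit_leb"
    using Lp_cballD(4)[OF assms(2)] assms(3) by (rule borel_measurable_ae_eq)
  show "AE x in unit_leb. \<bar>g x\<bar> \<le> \<bar>f x\<bar>"
    using assms(3) unfolding ae_eq_def by (rule eventually_mono) simp
qed

text \<open>The pointwise core of Minkowski's inequality: a + b is C + D times the average of a / C
  and b / D with weights C / (C + D) and D / (C + D), and z powr r is convex.\<close>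

lemma convex_powr_sum:
  fixes a b :: real
  assumes r: "1 \<le> r" and "0 \<le> a" "0 \<le> b" "0 < C" "0 < D"
  shows "(a + b) powr r \<le> (C + D) powr r * (C / (C + D) * (a / C) powr r + D / (C + D) * (b / D) powr r)"
proof -
  \<comment> \<open>A zero argument leaves a single term, for which a weight w \<le> 1 satisfies w
    powr r \<le> w.\<close>
  have conv: "(u * x + v * y) powr r \<le> u * x powr r + v * y powr r"
    if "0 \<le> x" "0 \<le> y" "0 < u" "0 < v" "u + v = 1" for u v x y :: real
  proof (cases "x = 0 \<or> y = 0")
    case True
    have *: "(w * z) powr r \<le> w * z powr r" if "0 < w" "w \<le> 1" "0 \<le> z" for w z :: real
    proof -
      have "w powr r \<le> w powr 1" using that r by (intro powr_mono') auto
      then show ?thesis using that by (simp add: powr_mult mult_right_mono)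
    qed
    show ?thesis using True that *[of u x] *[of v y] r by auto
  next
    case False
    have u: "u = 1 - v" using that by simp
    show ?thesis
      using convex_onD[OF powr_convex[OF r], of v x y] that False by (simp add: u)
  qed
  have "a + b = (C + D) * (C / (C + D) * (a / C) + D / (C + D) * (b / D))"
    using assms by (simp add: distrib_left)
  also have "\<dots> powr r = (C + D) powr r * (C / (C + D) * (a / C) + D / (C + D) * (b / D)) powr r"
    by (rule powr_mult)
  also have "\<dots> \<le> (C + D) powr r * (C / (C + D) * (a / C) powr r + D / (C + D) * (b / D) powr r)"
    using assms by (intro mult_left_mono conv) (auto simp: add_divide_distrib[symmetric])
  finally show ?thesis .
qed

lemma Lp_cball_scale:
  assumes p: "1 \<le> p" and f: "f \<in> Lp_cball p C"
  shows "(\<lambda>x. c * f x) \<in> Lp_cball p (\<bar>c\<bar> * C)"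
proof (cases p)
  case (real r)
  with p have r: "1 \<le> r" by simp
  have C: "0 \<le> C" and m: "f \<in> borel_measurable unit_leb" using f by (auto dest: Lp_cballD)
  have "(\<integral>\<^sup>+x. ennreal (\<bar>c * f x\<bar> powr r) \<partial>unit_leb) =
      (\<integral>\<^sup>+x. ennreal (\<bar>c\<bar> powr r) * ennreal (\<bar>f x\<bar> powr r) \<partial>unit_leb)"
    by (simp add: abs_mult powr_mult ennreal_mult)
  also have "\<dots> = ennreal (\<bar>c\<bar> powr r) * (\<integral>\<^sup>+x. ennreal (\<bar>f x\<bar> powr r) \<partial>unit_leb)"
    using m by (intro nn_integral_cmult) simp
  also have "\<dots> \<le> ennreal (\<bar>c\<bar> powr r) * ennreal (C powr r)"
    using f r C real by (intro mult_left_mono) (auto simp: Lp_cball_real)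
  also have "\<dots> = ennreal ((\<bar>c\<bar> * C) powr r)"
    using C by (simp add: powr_mult ennreal_mult)
  finally show ?thesis using m r C by (simp add: real Lp_cball_real)
next
  case PInf
  have C: "0 \<le> C" using f by (rule Lp_cballD)
  with f show ?thesis unfolding PInf
    by (auto simp: Lp_cball_infinity abs_mult elim!: eventually_mono intro!: mult_left_mono)
qed (use p in auto)

lemma Lp_cball_add:
  assumes p: "1 \<le> p" and f: "f \<in> Lp_cball p C" and g: "g \<in> Lp_cball p D"
  shows "(\<lambda>x. f x + g x) \<in> Lp_cball p (C + D)"
proof (cases p)
  case (real r)
  with p have r: "1 \<le> r" by simp
  have C: "0 \<le> C" and D: "0 \<le> D"
    and m [measurable]: "f \<in> borel_measurable unit_leb" "g \<in> borel_measurable unit_leb"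
    using f g by (auto dest: Lp_cballD)
  \<comment> \<open>C or D may be 0, so both radii are enlarged by e before dividing;
    \<open>field_le_epsilon\<close> removes the enlargement at the end.\<close>
  have le: "(\<lambda>x. f x + g x) \<in> Lp_cball p ((C + e) + (D + e))" if "0 < e" for e
  proof -
    define C' D' where "C' = C + e" and "D' = D + e"
    have pos: "0 < C'" "0 < D'" using C D that by (auto simp: C'_def D'_def)
    have scaled: "(\<integral>\<^sup>+x. ennreal ((\<bar>h x\<bar> / K) powr r) \<partial>unit_leb) \<le> 1"
      if "h \<in> Lp_cball p K" "0 < K" for h K
    proof -
      have "(\<lambda>x. (1 / K) * h x) \<in> Lp_cball (ereal r) 1"
        using Lp_cball_scale[OF p that(1), of "1 / K"] that(2) by (simp add: real)
      then show ?thesis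
        using that(2) r by (auto simp: Lp_cball_real)
    qed
    have sc: "(\<integral>\<^sup>+x. ennreal ((\<bar>f x\<bar> / C') powr r) \<partial>unit_leb) \<le> 1"
      "(\<integral>\<^sup>+x. ennreal ((\<bar>g x\<bar> / D') powr r) \<partial>unit_leb) \<le> 1"
      using Lp_cball_mono[OF f, of C'] Lp_cball_mono[OF g, of D'] that pos
      by (auto intro!: scaled simp: C'_def D'_def)
    let ?K = "(C' + D') powr r"
    have "(\<integral>\<^sup>+x. ennreal (\<bar>f x + g x\<bar> powr r) \<partial>unit_leb) \<le>
       (\<integral>\<^sup>+x. ennreal (?K * (C' / (C' + D') * (\<bar>f x\<bar> / C') powr r + D' / (C' + D') * (\<bar>g x\<bar> / D') powr r)) \<partial>unit_leb)"
    proof (intro nn_integral_mono ennreal_leI)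
      fix x
      have "\<bar>f x + g x\<bar> powr r \<le> (\<bar>f x\<bar> + \<bar>g x\<bar>) powr r"
        using r by (intro powr_mono2) auto
      also have "\<dots> \<le> ?K * (C' / (C' + D') * (\<bar>f x\<bar> / C') powr r + D' / (C' + D') * (\<bar>g x\<bar> / D') powr r)"
        using r pos by (intro convex_powr_sum) auto
      finally show "\<bar>f x + g x\<bar> powr r \<le> \<dots>" .
    qed
    also have "\<dots> = (\<integral>\<^sup>+x. ennreal ?K * (ennreal (C' / (C' + D')) * ennreal ((\<bar>f x\<bar> / C') powr r)
        + ennreal (D' / (C' + D')) * ennreal ((\<bar>g x\<bar> / D') powr r)) \<partial>unit_leb)"
      using pos by (simp only: ennreal_mult ennreal_plus mult_nonneg_nonneg divide_nonneg_nonneg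
          add_nonneg_nonneg powr_ge_zero less_imp_le)
    also have "\<dots> = ennreal ?K * (ennreal (C' / (C' + D')) * (\<integral>\<^sup>+x. ennreal ((\<bar>f x\<bar> / C') powr r) \<partial>unit_leb)
        + ennreal (D' / (C' + D')) * (\<integral>\<^sup>+x. ennreal ((\<bar>g x\<bar> / D') powr r) \<partial>unit_leb))"
      by (simp add: nn_integral_cmult nn_integral_add)
    also have "\<dots> \<le> ennreal ?K * (ennreal (C' / (C' + D')) * 1 + ennreal (D' / (C' + D')) * 1)"
      using sc by (intro mult_left_mono add_mono) auto
    also have "\<dots> = ennreal ?K"
      using pos by (simp add: ennreal_plus[symmetric] add_divide_distrib[symmetric] del: ennreal_plus)
    finally show ?thesis
      using r pos by (simp add: real Lp_cball_real C'_def D'_def)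
  qed
  have "Lp_norm p (\<lambda>x. f x + g x) \<le> C + D"
  proof (rule field_le_epsilon)
    fix e :: real assume "0 < e"
    with le[of "e / 2"] show "Lp_norm p (\<lambda>x. f x + g x) \<le> C + D + e"
      by (simp add: Lp_cball_def)
  qed
  with le[of 1] show ?thesis by (simp add: Lp_cball_def)
next
  case PInf
  have "0 \<le> C" "0 \<le> D" using f g by (auto dest: Lp_cballD)
  with f g show ?thesis unfolding PInf
    by (auto simp: Lp_cball_infinity elim!: eventually_elim2)
qed (use p in auto)

lemma Lp_cball_diff:
  assumes "1 \<le> p" "f \<in> Lp_cball p C" "g \<in> Lp_cball p D"
  shows "(\<lambda>x. f x - g x) \<in> Lp_cball p (C + D)"
  using Lp_cball_add[OF assms(1,2) Lp_cball_scale[OF assms(1,3), of "-1"]] by simp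

lemma Lp_cball_zero: "1 \<le> p \<Longrightarrow> (\<lambda>x. 0) \<in> Lp_cball p 0"
  by (cases p) (auto simp: Lp_cball_real Lp_cball_infinity)

text \<open>The factor 2 comes from t \<le> 1 + t powr r for t = \<bar>f x\<bar> / K on a space of
  mass 1. This is cruder than Hoelder's inequality, but only finiteness and smallness in L^1
  matter.\<close>

lemma Lp_cball_L1:
  assumes p: "1 \<le> p" and f: "f \<in> Lp_cball p C"
  shows "integrable unit_leb f" "(LINT x|unit_leb. \<bar>f x\<bar>) \<le> 2 * C"
proof -
  have m [measurable]: "f \<in> borel_measurable unit_leb" using f by (rule Lp_cballD)
  have le: "(\<integral>\<^sup>+x. ennreal \<bar>f x\<bar> \<partial>unit_leb) \<le> ennreal (2 * K)"
    if fK: "f \<in> Lp_cball p K" and K: "0 < K" for K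
  proof (cases p)
    case (real r)
    with p have r: "1 \<le> r" by simp
    have fK': "(\<integral>\<^sup>+x. ennreal (\<bar>(1 / K) * f x\<bar> powr r) \<partial>unit_leb) \<le> 1"
      using Lp_cball_scale[OF p fK, of "1 / K"] K r by (simp add: real Lp_cball_real)
    have "(\<integral>\<^sup>+x. ennreal \<bar>f x\<bar> \<partial>unit_leb) \<le>
        (\<integral>\<^sup>+x. ennreal K * (1 + ennreal (\<bar>(1 / K) * f x\<bar> powr r)) \<partial>unit_leb)"
    proof (rule nn_integral_mono)
      fix x
      have *: "t \<le> 1 + t powr r" if "0 \<le> t" for t :: real
      proof (cases "t \<le> 1")
        case False
        then have "t powr 1 \<le> t powr r" using r by (intro powr_mono) auto
        with False show ?thesis by simp
      qed (simp add: add_increasing2)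
      have "\<bar>f x\<bar> = K * \<bar>(1 / K) * f x\<bar>" using K by (simp add: abs_mult)
      also have "\<dots> \<le> K * (1 + \<bar>(1 / K) * f x\<bar> powr r)"
        using K by (intro mult_left_mono *) auto
      finally have "ennreal \<bar>f x\<bar> \<le> ennreal (K * (1 + \<bar>(1 / K) * f x\<bar> powr r))"
        by (rule ennreal_leI)
      also have "\<dots> = ennreal K * (1 + ennreal (\<bar>(1 / K) * f x\<bar> powr r))"
        using K by (subst ennreal_mult) (auto simp: ennreal_plus)
      finally show "ennreal \<bar>f x\<bar> \<le> \<dots>" .
    qed
    also have "\<dots> = ennreal K * (1 + (\<integral>\<^sup>+x. ennreal (\<bar>(1 / K) * f x\<bar> powr r) \<partial>unit_leb))"
      by (simp add: nn_integral_cmult nn_integral_add emeasure_unit_leb del: times_divide_eq_left)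
    also have "\<dots> \<le> ennreal K * (1 + 1)"
      using fK' by (intro mult_left_mono add_mono) auto
    also have "\<dots> = ennreal (2 * K)"
      using K by (simp add: ennreal_mult mult.commute)
    finally show ?thesis .
  next
    case PInf
    have "(\<integral>\<^sup>+x. ennreal \<bar>f x\<bar> \<partial>unit_leb) \<le> (\<integral>\<^sup>+x. ennreal (2 * K) \<partial>unit_leb)"
      using fK K by (intro nn_integral_mono_AE)
        (auto simp: PInf Lp_cball_infinity elim!: eventually_mono intro!: ennreal_leI)
    then show ?thesis by (simp add: emeasure_unit_leb)
  qed (use p in auto)
  have C: "0 \<le> C" using f by (rule Lp_cballD)
  have "(\<integral>\<^sup>+x. ennreal (norm (f x)) \<partial>unit_leb) < \<infinity>"
    using le_less_trans[OF le[OF Lp_cball_mono[OF f, of "C + 1"]] ennreal_less_top] C by simp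
  then show int: "integrable unit_leb f"
    by (intro integrableI_bounded m)
  show "(LINT x|unit_leb. \<bar>f x\<bar>) \<le> 2 * C"
  proof (rule field_le_epsilon)
    fix e :: real assume e: "0 < e"
    have "ennreal (LINT x|unit_leb. \<bar>f x\<bar>) = (\<integral>\<^sup>+x. ennreal \<bar>f x\<bar> \<partial>unit_leb)"
      using int by (subst nn_integral_eq_integral) auto
    also have "\<dots> \<le> ennreal (2 * (C + e / 2))"
      using C e by (intro le Lp_cball_mono[OF f]) auto
    finally show "(LINT x|unit_leb. \<bar>f x\<bar>) \<le> 2 * C + e"
      using C e by (subst (asm) ennreal_le_iff) (auto simp: algebra_simps)
  qed
qed

section \<open>Series in L^p\<close>

lemma Lp_cball_sum:
  assumes p: "1 \<le> p" and f: "\<And>n. f n \<in> Lp_cball p (C n)"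
  shows "(\<lambda>x. \<Sum>n<(k::nat). f n x) \<in> Lp_cball p (\<Sum>n<k. C n)"
proof (induction k)
  case 0
  then show ?case using Lp_cball_zero[OF p] by simp
next
  case (Suc k)
  then show ?case using Lp_cball_add[OF p Suc f] by simp
qed

text \<open>Completeness of L^p for absolutely convergent series. The L^1 bounds give convergence at
  almost every point, so the limit is a concrete pointwise sum; the radius survives by Fatou's lemma
  for finite p and by pointwise limits for p = \<infinity>.\<close>

lemma Lp_cball_suminf:
  assumes p: "1 \<le> p" and f: "\<And>n. f n \<in> Lp_cball p (C n)" and C: "summable C"
  shows "AE x in unit_leb. summable (\<lambda>n. \<bar>f n x\<bar>)"
    and "(\<lambda>x. \<Sum>n. f n x) \<in> Lp_cball p (suminf C)"
proof -
  have [measurable]: "\<And>n. f n \<in> borel_measurable unit_leb" and C0: "\<And>n. 0 \<le> C n"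
    using f by (auto dest: Lp_cballD)
  have fn: "(\<integral>\<^sup>+x. ennreal \<bar>f n x\<bar> \<partial>unit_leb) \<le> ennreal (2 * C n)" for n
    using Lp_cball_L1[OF p f[of n]] by (subst nn_integral_eq_integral) (auto intro!: ennreal_leI)
  have "(\<integral>\<^sup>+x. (\<Sum>n. ennreal \<bar>f n x\<bar>) \<partial>unit_leb) = (\<Sum>n. \<integral>\<^sup>+x. ennreal \<bar>f n x\<bar> \<partial>unit_leb)"
    by (rule nn_integral_suminf) simp
  also have "\<dots> \<le> (\<Sum>n. ennreal (2 * C n))"
    by (intro suminf_le fn) auto
  also have "\<dots> = ennreal (\<Sum>n. 2 * C n)"
    using C C0 by (intro suminf_ennreal2) auto
  also have "\<dots> < \<infinity>" by simp
  finally have "AE x in unit_leb. (\<Sum>n. ennreal \<bar>f n x\<bar>) \<noteq> \<infinity>"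
    by (intro nn_integral_PInf_AE) auto
  then show sm: "AE x in unit_leb. summable (\<lambda>n. \<bar>f n x\<bar>)"
    by (rule eventually_mono) (auto intro!: summable_suminf_not_top)
  define F where "F = (\<lambda>k x. \<Sum>n<k. \<bar>f n x\<bar>)"
  have lim: "AE x in unit_leb. (\<lambda>k. F k x) \<longlonglongrightarrow> (\<Sum>n. \<bar>f n x\<bar>)"
    using sm by (rule eventually_mono) (auto simp: F_def intro: summable_LIMSEQ)
  have FC: "F k \<in> Lp_cball p (suminf C)" for k
  proof -
    have "F k \<in> Lp_cball p (\<Sum>n<k. C n)"
      unfolding F_def
      by (intro Lp_cball_sum[OF p] Lp_cball_dominated[OF p f]) auto
    then show ?thesis
      by (rule Lp_cball_mono) (use C C0 in \<open>auto intro: sum_le_suminf\<close>)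
  qed
  have C': "0 \<le> suminf C" using C C0 by (rule suminf_nonneg)
  have "(\<lambda>x. \<Sum>n. \<bar>f n x\<bar>) \<in> Lp_cball p (suminf C)"
  proof (cases p)
    case (real r)
    with p have r: "1 \<le> r" by simp
    have "(\<integral>\<^sup>+x. ennreal (\<bar>\<Sum>n. \<bar>f n x\<bar>\<bar> powr r) \<partial>unit_leb) =
        (\<integral>\<^sup>+x. liminf (\<lambda>k. ennreal (\<bar>F k x\<bar> powr r)) \<partial>unit_leb)"
    proof (rule nn_integral_cong_AE, use lim in eventually_elim)
      case (elim x)
      have "(\<lambda>k. ennreal (\<bar>F k x\<bar> powr r)) \<longlonglongrightarrow> ennreal (\<bar>\<Sum>n. \<bar>f n x\<bar>\<bar> powr r)"
        using r elim by (intro tendsto_ennrealI tendsto_powr' tendsto_intros tendsto_rabs) auto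
      from lim_imp_Liminf[OF _ this] show ?case by simp
    qed
    also have "\<dots> \<le> liminf (\<lambda>k. \<integral>\<^sup>+x. ennreal (\<bar>F k x\<bar> powr r) \<partial>unit_leb)"
      by (rule nn_integral_liminf) (simp add: F_def)
    also have "\<dots> \<le> ennreal (suminf C powr r)"
      using FC r C' by (intro Liminf_le) (auto simp: real Lp_cball_real)
    finally show ?thesis using r C' by (simp add: real Lp_cball_real)
  next
    case PInf
    have "AE x in unit_leb. \<forall>k. \<bar>F k x\<bar> \<le> suminf C"
      using FC C' by (auto simp: PInf Lp_cball_infinity AE_all_countable)
    then have "AE x in unit_leb. \<bar>\<Sum>n. \<bar>f n x\<bar>\<bar> \<le> suminf C"
      using lim
    proof eventually_elim
      case (elim x)
      have "(\<lambda>k. \<bar>F k x\<bar>) \<longlonglongrightarrow> \<bar>\<Sum>n. \<bar>f n x\<bar>\<bar>" using elim(2) by (rule tendsto_rabs)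
      then show ?case by (rule LIMSEQ_le_const2) (use elim(1) in auto)
    qed
    with C' show ?thesis by (simp add: PInf Lp_cball_infinity)
  qed (use p in auto)
  then show "(\<lambda>x. \<Sum>n. f n x) \<in> Lp_cball p (suminf C)"
  proof (rule Lp_cball_dominated[OF p])
    show "AE x in unit_leb. \<bar>\<Sum>n. f n x\<bar> \<le> \<bar>\<Sum>n. \<bar>f n x\<bar>\<bar>"
      using sm by (rule eventually_mono) (rule order_trans[OF summable_rabs abs_ge_self])
  qed simp
qed

section \<open>Almost everywhere equality and convergence in norm\<close>

lemma ae_eq_refl: "ae_eq f f"
  by (simp add: ae_eq_def)

lemma ae_eq_add: "ae_eq f f' \<Longrightarrow> ae_eq g g' \<Longrightarrow> ae_eq (\<lambda>x. f x + g x) (\<lambda>x. f' x + g' x)"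
  unfolding ae_eq_def by (auto elim: eventually_elim2)

lemma ae_eq_diff: "ae_eq f f' \<Longrightarrow> ae_eq g g' \<Longrightarrow> ae_eq (\<lambda>x. f x - g x) (\<lambda>x. f' x - g' x)"
  unfolding ae_eq_def by (auto elim: eventually_elim2)

lemma Lp_iff_cball: "f \<in> Lp p \<longleftrightarrow> (\<exists>C. f \<in> Lp_cball p C)"
  by (auto simp: Lp_cball_def)

lemma Lp_add: "1 \<le> p \<Longrightarrow> f \<in> Lp p \<Longrightarrow> g \<in> Lp p \<Longrightarrow> (\<lambda>x. f x + g x) \<in> Lp p"
  unfolding Lp_iff_cball using Lp_cball_add by blast

lemma Lp_diff: "1 \<le> p \<Longrightarrow> f \<in> Lp p \<Longrightarrow> g \<in> Lp p \<Longrightarrow> (\<lambda>x. f x - g x) \<in> Lp p"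
  unfolding Lp_iff_cball using Lp_cball_diff by blast

lemma Lp_scale: "1 \<le> p \<Longrightarrow> f \<in> Lp p \<Longrightarrow> (\<lambda>x. c * f x) \<in> Lp p"
  unfolding Lp_iff_cball using Lp_cball_scale by blast

lemma Lp_ae_eq: "1 \<le> p \<Longrightarrow> f \<in> Lp p \<Longrightarrow> ae_eq f g \<Longrightarrow> g \<in> Lp p"
  unfolding Lp_iff_cball using Lp_cball_ae_eq by blast

lemma Lp_integrable: "1 \<le> p \<Longrightarrow> f \<in> Lp p \<Longrightarrow> integrable unit_leb f"
  by (rule Lp_cball_L1(1)[OF _ Lp_cball_norm])

lemma ae_eqI_L1:
  assumes "integrable unit_leb f" "(LINT x|unit_leb. \<bar>f x\<bar>) \<le> 0"
  shows "ae_eq f (\<lambda>x. 0)"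
proof -
  have "(LINT x|unit_leb. \<bar>f x\<bar>) = 0"
    using assms(2) by (intro antisym) auto
  then show ?thesis
    using integral_nonneg_eq_0_iff_AE[of unit_leb "\<lambda>x. \<bar>f x\<bar>"] assms(1) by (simp add: ae_eq_def)
qed

lemma ae_eqI_cball:
  assumes p: "1 \<le> p" and f: "\<And>e. 0 < e \<Longrightarrow> (\<lambda>x. f x - g x) \<in> Lp_cball p e"
  shows "ae_eq f g"
proof -
  have "ae_eq (\<lambda>x. f x - g x) (\<lambda>x. 0)"
  proof (rule ae_eqI_L1)
    show "integrable unit_leb (\<lambda>x. f x - g x)"
      by (rule Lp_cball_L1[OF p f[of 1]]) simp
    show "(LINT x|unit_leb. \<bar>f x - g x\<bar>) \<le> 0"
    proof (rule field_le_epsilon)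
      fix e :: real assume "0 < e"
      then show "(LINT x|unit_leb. \<bar>f x - g x\<bar>) \<le> 0 + e"
        using Lp_cball_L1(2)[OF p f[of "e / 2"]] by simp
    qed
  qed
  then show ?thesis by (simp add: ae_eq_def)
qed

text \<open>Radius 0 translates between identities and norm estimates, so that an operator bound can
  prove an identity.\<close>

lemma Lp_cball_0_iff:
  assumes "1 \<le> p"
  shows "(\<lambda>x. f x - g x) \<in> Lp_cball p 0 \<longleftrightarrow> ae_eq f g"
proof
  assume "(\<lambda>x. f x - g x) \<in> Lp_cball p 0"
  then show "ae_eq f g"
    by (intro ae_eqI_cball[OF assms]) (auto elim: Lp_cball_mono)
next
  assume "ae_eq f g"
  then show "(\<lambda>x. f x - g x) \<in> Lp_cball p 0"
    by (intro Lp_cball_ae_eq[OF assms Lp_cball_zero[OF assms]]) (auto simp: ae_eq_def)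
qed

lemma Lp_tendstoI:
  assumes "\<forall>\<^sub>F s in F. (\<lambda>x. u s x - f x) \<in> Lp_cball p (d s)" "(d \<longlongrightarrow> 0) F"
  shows "Lp_tendsto p u f F"
  unfolding Lp_tendsto_def
proof (rule tendsto_sandwich[OF _ _ tendsto_const assms(2)])
  show "\<forall>\<^sub>F s in F. 0 \<le> Lp_norm p (\<lambda>x. u s x - f x)"
    by (simp add: Lp_norm_nonneg)
  show "\<forall>\<^sub>F s in F. Lp_norm p (\<lambda>x. u s x - f x) \<le> d s"
    using assms(1) by (rule eventually_mono) (rule Lp_cballD)
qed

subsection \<open>Bounded linear operators\<close>

lemma Lp_bounded_linearD:
  assumes "Lp_bounded_linear p A"
  shows "f \<in> Lp p \<Longrightarrow> A f \<in> Lp p"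
    "f \<in> Lp p \<Longrightarrow> g \<in> Lp p \<Longrightarrow> ae_eq (A (\<lambda>x. f x + g x)) (\<lambda>x. A f x + A g x)"
    "f \<in> Lp p \<Longrightarrow> ae_eq (A (\<lambda>x. c * f x)) (\<lambda>x. c * A f x)"
  using assms by (auto simp: Lp_bounded_linear_def)

lemma Lp_bounded_linear_bound:
  assumes "Lp_bounded_linear p A"
  obtains C where "0 \<le> C" "\<And>f D. f \<in> Lp_cball p D \<Longrightarrow> A f \<in> Lp_cball p (C * D)"
proof -
  obtain C where C: "\<And>f. f \<in> Lp p \<Longrightarrow> Lp_norm p (A f) \<le> C * Lp_norm p f"
    using assms unfolding Lp_bounded_linear_def by blast
  \<comment> \<open>The constant in \<open>Lp_bounded_linear\<close> carries no sign;
    \<open>max 0 C\<close> keeps the product monotone in the norm.\<close>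
  have bound: "A f \<in> Lp_cball p (max 0 C * D)" if f: "f \<in> Lp_cball p D" for f D
  proof -
    have "Lp_norm p (A f) \<le> C * Lp_norm p f" using f by (intro C Lp_cballD)
    also have "\<dots> \<le> max 0 C * D"
      using Lp_cballD(2)[OF f] Lp_norm_nonneg[of p f] by (intro mult_mono) auto
    finally show ?thesis
      using Lp_bounded_linearD(1)[OF assms] f by (simp add: Lp_cball_def)
  qed
  show ?thesis
  proof (rule that)
    show "0 \<le> max 0 C" by simp
  qed (rule bound)
qed

lemma Lp_bounded_linearI:
  assumes "\<And>f D. f \<in> Lp_cball p D \<Longrightarrow> A f \<in> Lp_cball p (C * D)"
    and "\<And>f g. f \<in> Lp p \<Longrightarrow> g \<in> Lp p \<Longrightarrow> ae_eq (A (\<lambda>x. f x + g x)) (\<lambda>x. A f x + A g x)"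
    and "\<And>f c. f \<in> Lp p \<Longrightarrow> ae_eq (A (\<lambda>x. c * f x)) (\<lambda>x. c * A f x)"
  shows "Lp_bounded_linear p A"
  unfolding Lp_bounded_linear_def
  using assms(2,3) Lp_cballD(1,2)[OF assms(1)[OF Lp_cball_norm]] by blast

lemma Lp_bounded_linear_diff:
  assumes p: "1 \<le> p" and A: "Lp_bounded_linear p A" and fg: "f \<in> Lp p" "g \<in> Lp p"
  shows "ae_eq (A (\<lambda>x. f x - g x)) (\<lambda>x. A f x - A g x)"
proof -
  have "ae_eq (A (\<lambda>x. f x + (-1) * g x)) (\<lambda>x. A f x + A (\<lambda>x. (-1) * g x) x)"
    using fg by (intro Lp_bounded_linearD(2)[OF A] Lp_scale[OF p])
  also have "ae_eq \<dots> (\<lambda>x. A f x + (-1) * A g x)"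
    using fg by (intro ae_eq_add ae_eq_refl Lp_bounded_linearD(3)[OF A])
  finally show ?thesis by simp
qed

text \<open>Well-definedness on equivalence classes: the bound maps radius 0 to radius 0, and
  linearity splits \<open>A\<close> of the difference.\<close>

lemma Lp_bounded_linear_cong:
  assumes p: "1 \<le> p" and A: "Lp_bounded_linear p A" and f: "f \<in> Lp p" and eq: "ae_eq f g"
  shows "ae_eq (A f) (A g)"
proof -
  obtain C where C: "\<And>f D. f \<in> Lp_cball p D \<Longrightarrow> A f \<in> Lp_cball p (C * D)"
    using Lp_bounded_linear_bound[OF A] by metis
  have "(\<lambda>x. f x - g x) \<in> Lp_cball p 0" using eq by (simp add: Lp_cball_0_iff[OF p])
  from C[OF this] have "A (\<lambda>x. f x - g x) \<in> Lp_cball p 0" by simp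
  then have "(\<lambda>x. A f x - A g x) \<in> Lp_cball p 0"
    using Lp_bounded_linear_diff[OF p A f Lp_ae_eq[OF p f eq]] by (rule Lp_cball_ae_eq[OF p])
  then show ?thesis by (simp add: Lp_cball_0_iff[OF p])
qed

lemma Lp_bounded_linear_funpow:
  assumes p: "1 \<le> p" and A: "Lp_bounded_linear p A"
  shows "Lp_bounded_linear p (A ^^ n)"
proof (induction n)
  case 0
  show ?case by (rule Lp_bounded_linearI[of p _ 1]) (auto simp: ae_eq_refl)
next
  case (Suc n)
  obtain C where C: "\<And>f D. f \<in> Lp_cball p D \<Longrightarrow> A f \<in> Lp_cball p (C * D)"
    using Lp_bounded_linear_bound[OF A] by metis
  obtain K where K: "\<And>f D. f \<in> Lp_cball p D \<Longrightarrow> (A ^^ n) f \<in> Lp_cball p (K * D)"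
    using Lp_bounded_linear_bound[OF Suc] by metis
  note An = Lp_bounded_linearD[OF Suc] and A1 = Lp_bounded_linearD[OF A]
  show ?case
  proof (rule Lp_bounded_linearI[of p _ "C * K"])
    fix f D assume "f \<in> Lp_cball p D"
    then show "(A ^^ Suc n) f \<in> Lp_cball p (C * K * D)"
      using C[OF K] by (simp add: mult.assoc)
  next
    fix f g assume fg: "f \<in> Lp p" "g \<in> Lp p"
    have "ae_eq (A ((A ^^ n) (\<lambda>x. f x + g x))) (A (\<lambda>x. (A ^^ n) f x + (A ^^ n) g x))"
      using fg by (intro Lp_bounded_linear_cong[OF p A] An Lp_add[OF p])
    also have "ae_eq \<dots> (\<lambda>x. A ((A ^^ n) f) x + A ((A ^^ n) g) x)"
      using fg by (intro A1 An)
    finally show "ae_eq ((A ^^ Suc n) (\<lambda>x. f x + g x)) (\<lambda>x. (A ^^ Suc n) f x + (A ^^ Suc n) g x)"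
      by simp
  next
    fix f c assume f: "f \<in> Lp p"
    have "ae_eq (A ((A ^^ n) (\<lambda>x. c * f x))) (A (\<lambda>x. c * (A ^^ n) f x))"
      using f by (intro Lp_bounded_linear_cong[OF p A] An Lp_scale[OF p])
    also have "ae_eq \<dots> (\<lambda>x. c * A ((A ^^ n) f) x)"
      using f by (intro A1 An)
    finally show "ae_eq ((A ^^ Suc n) (\<lambda>x. c * f x)) (\<lambda>x. c * (A ^^ Suc n) f x)"
      by simp
  qed
qed

lemma Lp_bounded_linear_sum:
  fixes k :: nat
  assumes p: "1 \<le> p" and A: "Lp_bounded_linear p A" and f: "\<And>n. f n \<in> Lp p"
  shows "(\<lambda>x. \<Sum>n<k. f n x) \<in> Lp p \<and> ae_eq (A (\<lambda>x. \<Sum>n<k. f n x)) (\<lambda>x. \<Sum>n<k. A (f n) x)"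
proof (induction k)
  case 0
  have z: "(\<lambda>x. 0) \<in> Lp p" using Lp_cball_zero[OF p] by (rule Lp_cballD)
  \<comment> \<open>Homogeneity with the scalar 0 sends the empty sum to 0.\<close>
  then show ?case using Lp_bounded_linearD(3)[OF A z, of 0] by simp
next
  case (Suc k)
  then have S: "(\<lambda>x. \<Sum>n<k. f n x) \<in> Lp p"
    and eq: "ae_eq (A (\<lambda>x. \<Sum>n<k. f n x)) (\<lambda>x. \<Sum>n<k. A (f n) x)" by auto
  have "ae_eq (A (\<lambda>x. (\<Sum>n<k. f n x) + f k x)) (\<lambda>x. A (\<lambda>x. \<Sum>n<k. f n x) x + A (f k) x)"
    by (rule Lp_bounded_linearD(2)[OF A S f])
  also have "ae_eq \<dots> (\<lambda>x. (\<Sum>n<k. A (f n) x) + A (f k) x)"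
    by (intro ae_eq_add eq ae_eq_refl)
  finally show ?case using Lp_add[OF p S f] by simp
qed

text \<open>For coefficients of a power series this is multiplication by the variable. For t ^ n /
  fact n it is also differentiation in t; the derivative of \<open>heat\<close> rests on the
  coincidence of the two.\<close>

definition shift :: "(nat \<Rightarrow> real) \<Rightarrow> nat \<Rightarrow> real" where
  "shift a n = (case n of 0 \<Rightarrow> 0 | Suc m \<Rightarrow> a m)"

lemma shift_sums: "(\<lambda>n. shift a n * h n) sums s \<longleftrightarrow> (\<lambda>n. a n * h (Suc n)) sums s"
  using sums_Suc_iff[of "\<lambda>n. shift a n * h n" s] by (simp add: shift_def)

subsection \<open>Power series in a contraction\<close>

text \<open>\<open>B_L1\<close> is a separate requirement because \<open>B_cball\<close> controls
  only the norm for the given p, while uniqueness is proved in the L^1 norm.\<close>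

locale Lp_contraction =
  fixes p :: ereal and B :: "(real \<Rightarrow> real) \<Rightarrow> real \<Rightarrow> real"
  assumes p: "1 \<le> p"
    and B_linear: "Lp_bounded_linear p B"
    and B_cball: "f \<in> Lp_cball p C \<Longrightarrow> B f \<in> Lp_cball p C"
    and B_L1: "f \<in> Lp p \<Longrightarrow> (LINT x|unit_leb. \<bar>B f x\<bar>) \<le> (LINT x|unit_leb. \<bar>f x\<bar>)"
begin

text \<open>The sum is pointwise for a fixed representative; for absolutely summable
  \<open>a\<close> and \<open>f\<close> in \<open>Lp p\<close> it diverges at most on a null
  set.\<close>

definition ser :: "(nat \<Rightarrow> real) \<Rightarrow> (real \<Rightarrow> real) \<Rightarrow> real \<Rightarrow> real" where
  "ser a f x = (\<Sum>n. a n * (B ^^ n) f x)"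

lemma B_funpow_cball: "f \<in> Lp_cball p C \<Longrightarrow> (B ^^ n) f \<in> Lp_cball p C"
  by (induction n) (auto intro: B_cball)

lemmas B_funpow_linear = Lp_bounded_linear_funpow[OF p B_linear]

lemma ser_term_cball: "f \<in> Lp_cball p C \<Longrightarrow> (\<lambda>x. a n * (B ^^ n) f x) \<in> Lp_cball p (\<bar>a n\<bar> * C)"
  by (intro Lp_cball_scale[OF p] B_funpow_cball)

lemma ser_summable:
  assumes a: "summable (\<lambda>n. \<bar>a n\<bar>)" and f: "f \<in> Lp p"
  shows "AE x in unit_leb. summable (\<lambda>n. a n * (B ^^ n) f x)"
  using Lp_cball_suminf(1)[OF p ser_term_cball[OF Lp_cball_norm[OF f], of a] summable_mult2[OF a]]
  by (rule eventually_mono) (rule summable_rabs_cancel)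

lemma ser_cball:
  assumes a: "summable (\<lambda>n. \<bar>a n\<bar>)" and f: "f \<in> Lp_cball p C"
  shows "ser a f \<in> Lp_cball p ((\<Sum>n. \<bar>a n\<bar>) * C)"
proof -
  have "(\<lambda>x. \<Sum>n. a n * (B ^^ n) f x) \<in> Lp_cball p (\<Sum>n. \<bar>a n\<bar> * C)"
    by (rule Lp_cball_suminf(2)[OF p ser_term_cball[OF f, of a] summable_mult2[OF a]])
  also have "(\<Sum>n. \<bar>a n\<bar> * C) = (\<Sum>n. \<bar>a n\<bar>) * C"
    using a by (rule suminf_mult2[symmetric])
  finally show ?thesis by (simp add: ser_def[abs_def])
qed

lemma ser_Lp: "summable (\<lambda>n. \<bar>a n\<bar>) \<Longrightarrow> f \<in> Lp p \<Longrightarrow> ser a f \<in> Lp p"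
  by (rule Lp_cballD[OF ser_cball[OF _ Lp_cball_norm]])

lemma ser_lincomb:
  assumes "summable (\<lambda>n. \<bar>a n\<bar>)" "summable (\<lambda>n. \<bar>b n\<bar>)" "f \<in> Lp p"
  shows "ae_eq (ser (\<lambda>n. c * a n + d * b n) f) (\<lambda>x. c * ser a f x + d * ser b f x)"
  using ser_summable[OF assms(1,3)] ser_summable[OF assms(2,3)] unfolding ae_eq_def
proof eventually_elim
  case (elim x)
  from suminf_add[OF summable_mult[OF elim(1), of c] summable_mult[OF elim(2), of d]]
  show ?case using elim by (simp add: ser_def suminf_mult algebra_simps)
qed

lemma ser_linear:
  assumes a: "summable (\<lambda>n. \<bar>a n\<bar>)"
  shows "Lp_bounded_linear p (ser a)"
proof (rule Lp_bounded_linearI)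
  fix f D assume "f \<in> Lp_cball p D"
  then show "ser a f \<in> Lp_cball p ((\<Sum>n. \<bar>a n\<bar>) * D)" by (rule ser_cball[OF a])
next
  fix f g assume fg: "f \<in> Lp p" "g \<in> Lp p"
  have "AE x in unit_leb. \<forall>n. (B ^^ n) (\<lambda>x. f x + g x) x = (B ^^ n) f x + (B ^^ n) g x"
    using Lp_bounded_linearD(2)[OF B_funpow_linear fg] by (simp add: AE_all_countable ae_eq_def)
  then show "ae_eq (ser a (\<lambda>x. f x + g x)) (\<lambda>x. ser a f x + ser a g x)"
    using ser_summable[OF a fg(1)] ser_summable[OF a fg(2)] unfolding ae_eq_def
    by eventually_elim (simp add: ser_def suminf_add distrib_left)
next
  fix f c assume f: "f \<in> Lp p"
  have "AE x in unit_leb. \<forall>n. (B ^^ n) (\<lambda>x. c * f x) x = c * (B ^^ n) f x"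
    using Lp_bounded_linearD(3)[OF B_funpow_linear f] by (simp add: AE_all_countable ae_eq_def)
  then show "ae_eq (ser a (\<lambda>x. c * f x)) (\<lambda>x. c * ser a f x)"
    using ser_summable[OF a f] unfolding ae_eq_def
    by eventually_elim (simp add: ser_def suminf_mult mult.left_commute)
qed

text \<open>\<open>(B ^^ Suc n) f\<close> is literally \<open>(B ^^ n) (B f)\<close>, so reindexing
  uses no linearity; \<open>B_ser\<close> then moves \<open>B\<close> in front of the sum.\<close>

lemma ser_shift:
  assumes a: "summable (\<lambda>n. \<bar>a n\<bar>)" and f: "f \<in> Lp p"
  shows "ae_eq (ser (shift a) f) (ser a (B f))"
  using ser_summable[OF a Lp_bounded_linearD(1)[OF B_linear f]] unfolding ae_eq_def
proof eventually_elim
  case (elim x)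
  then have "(\<lambda>n. a n * (B ^^ n) (B f) x) sums ser a (B f) x"
    unfolding ser_def by (rule summable_sums)
  then have "(\<lambda>n. shift a n * (B ^^ n) f x) sums ser a (B f) x"
    by (simp add: shift_sums funpow_swap1)
  then show ?case unfolding ser_def by (rule sums_unique[symmetric])
qed

text \<open>Linearity reaches only finite sums, so the sequence is cut at k. The head
  \<open>a1\<close> commutes with \<open>B\<close> by linearity; by contraction each of the two tail
  terms is at most the tail of the coefficient sum times the norm of \<open>f\<close>.\<close>

lemma B_ser:
  assumes a: "summable (\<lambda>n. \<bar>a n\<bar>)" and f: "f \<in> Lp p"
  shows "ae_eq (B (ser a f)) (ser a (B f))"
proof (rule ae_eqI_cball[OF p])
  fix e :: real assume e: "0 < e"
  let ?C = "Lp_norm p f"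
  have C: "0 \<le> ?C" by (rule Lp_norm_nonneg)
  have Bf: "B f \<in> Lp p" "B f \<in> Lp_cball p ?C"
    using B_cball[OF Lp_cball_norm[OF f]] by (auto dest: Lp_cballD)
  \<comment> \<open>The 2 serves the two tail terms; the + 1 avoids a division by 0 when the norm of
    \<open>f\<close> vanishes.\<close>
  obtain k where k: "(\<Sum>n. \<bar>a (n + k)\<bar>) < e / (2 * (?C + 1))"
  proof -
    obtain N where "\<forall>n\<ge>N. norm (\<Sum>i. \<bar>a (i + n)\<bar>) < e / (2 * (?C + 1))"
      using suminf_exist_split[OF _ a, of "e / (2 * (?C + 1))"] e C by auto
    then show ?thesis by (intro that[of N]) (auto dest!: spec[of _ N])
  qed
  define a1 where "a1 n = (if n < k then a n else 0)" for n
  define a2 where "a2 n = (if n < k then 0 else a n)" for n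
  have sa: "summable (\<lambda>n. \<bar>a1 n\<bar>)" "summable (\<lambda>n. \<bar>a2 n\<bar>)"
    by (auto intro: summable_comparison_test'[OF a] simp: a1_def a2_def)
  have a12: "(\<lambda>n. 1 * a1 n + 1 * a2 n) = a" by (auto simp: a1_def a2_def)
  have split: "ae_eq (ser a g) (\<lambda>x. ser a1 g x + ser a2 g x)" if "g \<in> Lp p" for g
    using ser_lincomb[OF sa that, of 1 1] unfolding a12 by simp
  have ser1: "ser a1 g = (\<lambda>x. \<Sum>n<k. a n * (B ^^ n) g x)" for g
  proof
    fix x show "ser a1 g x = (\<Sum>n<k. a n * (B ^^ n) g x)"
      unfolding ser_def by (subst suminf_finite[of "{..<k}"]) (auto simp: a1_def)
  qed
  have "ae_eq (B (ser a1 f)) (\<lambda>x. \<Sum>n<k. B (\<lambda>x. a n * (B ^^ n) f x) x)"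
    unfolding ser1
    by (intro Lp_bounded_linear_sum[OF p B_linear, THEN conjunct2] Lp_scale[OF p]
        Lp_bounded_linearD(1)[OF B_funpow_linear f])
  also have "ae_eq \<dots> (\<lambda>x. \<Sum>n<k. a n * (B ^^ n) (B f) x)"
  proof -
    have "ae_eq (B (\<lambda>x. a n * (B ^^ n) f x)) (\<lambda>x. a n * (B ^^ n) (B f) x)" for n
      using Lp_bounded_linearD(3)[OF B_linear Lp_bounded_linearD(1)[OF B_funpow_linear f]]
      by (simp add: funpow_swap1)
    then have "AE x in unit_leb. \<forall>n. B (\<lambda>x. a n * (B ^^ n) f x) x = a n * (B ^^ n) (B f) x"
      by (simp add: ae_eq_def AE_all_countable)
    then show ?thesis unfolding ae_eq_def by (rule eventually_mono) simp
  qed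
  finally have B1: "ae_eq (B (ser a1 f)) (ser a1 (B f))" by (simp add: ser1)
  have "(\<Sum>n. \<bar>a2 n\<bar>) = (\<Sum>n. \<bar>a2 (n + k)\<bar>) + (\<Sum>n<k. \<bar>a2 n\<bar>)"
    by (rule suminf_split_initial_segment[OF sa(2)])
  also have "\<dots> = (\<Sum>n. \<bar>a (n + k)\<bar>)" by (simp add: a2_def)
  finally have "(\<Sum>n. \<bar>a2 n\<bar>) \<le> e / (2 * (?C + 1))" using k by simp
  then have small: "(\<Sum>n. \<bar>a2 n\<bar>) * ?C + (\<Sum>n. \<bar>a2 n\<bar>) * ?C \<le> e"
  proof -
    assume le: "(\<Sum>n. \<bar>a2 n\<bar>) \<le> e / (2 * (?C + 1))"
    have "(\<Sum>n. \<bar>a2 n\<bar>) * ?C \<le> e / (2 * (?C + 1)) * (?C + 1)"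
      using C e sa(2) by (intro mult_mono le) (auto intro: suminf_nonneg)
    also have "\<dots> = e / 2" using C by (simp add: field_simps)
    finally show ?thesis by linarith
  qed
  have "(\<lambda>x. B (ser a2 f) x - ser a2 (B f) x) \<in> Lp_cball p e"
    by (intro Lp_cball_mono[OF Lp_cball_diff[OF p] small] B_cball ser_cball[OF sa(2)] Bf Lp_cball_norm[OF f])
  moreover have "ae_eq (\<lambda>x. B (ser a2 f) x - ser a2 (B f) x) (\<lambda>x. B (ser a f) x - ser a (B f) x)"
  proof -
    have "ae_eq (B (ser a f)) (B (\<lambda>x. ser a1 f x + ser a2 f x))"
      by (intro Lp_bounded_linear_cong[OF p B_linear] ser_Lp[OF a] split f)
    also have "ae_eq \<dots> (\<lambda>x. B (ser a1 f) x + B (ser a2 f) x)"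
      by (intro Lp_bounded_linearD(2)[OF B_linear] ser_Lp sa f)
    finally show ?thesis using B1 split[OF Bf(1)] unfolding ae_eq_def
      by eventually_elim simp
  qed
  ultimately show "(\<lambda>x. B (ser a f) x - ser a (B f) x) \<in> Lp_cball p e"
    by (rule Lp_cball_ae_eq[OF p])
qed

end

subsection \<open>Poisson weights\<close>

definition poisson :: "real \<Rightarrow> nat \<Rightarrow> real" where
  "poisson t n = exp (- t) * (t ^ n / fact n)"

lemma exp_sums_real: "(\<lambda>n. t ^ n / fact n) sums exp (t::real)"
  using exp_converges[of t] by (simp add: divide_inverse mult.commute)

lemma poisson_sums: "poisson t sums 1"
  using sums_mult[OF exp_sums_real[of t], of "exp (- t)"]
  by (simp add: poisson_def[abs_def] exp_minus_inverse mult.commute)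

lemma poisson_nonneg: "0 \<le> t \<Longrightarrow> 0 \<le> poisson t n"
  by (simp add: poisson_def)

lemma poisson_0: "poisson 0 n = (if n = 0 then 1 else 0)"
  by (simp add: poisson_def)

lemma abs_poisson_sums: "0 \<le> t \<Longrightarrow> (\<lambda>n. \<bar>poisson t n\<bar>) sums 1"
  using poisson_sums[of t] by (simp add: poisson_nonneg)

lemma summable_abs_poisson: "0 \<le> t \<Longrightarrow> summable (\<lambda>n. \<bar>poisson t n\<bar>)"
  using abs_poisson_sums by (rule sums_summable)

lemma summable_abs_shift:
  assumes "summable (\<lambda>n. \<bar>a n\<bar>)" shows "summable (\<lambda>n. \<bar>shift a n\<bar>)"
proof -
  have "\<bar>shift a n\<bar> = shift (\<lambda>n. \<bar>a n\<bar>) n * 1" for n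
    by (simp add: shift_def split: nat.split)
  moreover have "(\<lambda>n. shift (\<lambda>n. \<bar>a n\<bar>) n * 1) sums (\<Sum>n. \<bar>a n\<bar>)"
    unfolding shift_sums using summable_sums[OF assms] by simp
  ultimately show ?thesis by (simp add: sums_iff)
qed

section \<open>Differentiating the Poisson weights in l^1\<close>

lemma power_tangent_le:
  fixes s t :: real
  assumes "0 \<le> s" "0 \<le> t"
  shows "t ^ Suc m + real (Suc m) * t ^ m * (s - t) \<le> s ^ Suc m"
proof (induction m)
  case (Suc m)
  \<comment> \<open>The induction hypothesis times s is the next tangent plus a nonnegative square
    term.\<close>
  have "t ^ Suc (Suc m) + real (Suc (Suc m)) * t ^ Suc m * (s - t) + real (Suc m) * t ^ m * (s - t)\<^sup>2
      = s * (t ^ Suc m + real (Suc m) * t ^ m * (s - t))"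
    by (simp add: algebra_simps power2_eq_square)
  also have "\<dots> \<le> s * s ^ Suc m"
    using Suc assms by (intro mult_left_mono) auto
  finally have "t ^ Suc (Suc m) + real (Suc (Suc m)) * t ^ Suc m * (s - t) + real (Suc m) * t ^ m * (s - t)\<^sup>2
      \<le> s ^ Suc (Suc m)" by simp
  moreover have "0 \<le> real (Suc m) * t ^ m * (s - t)\<^sup>2" using assms by simp
  ultimately show ?case by linarith
qed simp

text \<open>The n-th weight has t-derivative \<open>shift (poisson t) n - poisson t n\<close>, so
  this is the error of a difference quotient, coefficient by coefficient.\<close>

definition poisson_quotient :: "real \<Rightarrow> real \<Rightarrow> nat \<Rightarrow> real" where
  "poisson_quotient t s n = (poisson s n - poisson t n) / (s - t) - (shift (poisson t) n - poisson t n)"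

text \<open>These are the product rule errors for exp (- t) times t ^ n / fact n, summed over n:
  both t ^ n / fact n and its t-derivative sum to exp t.\<close>

definition exp_defect :: "real \<Rightarrow> real \<Rightarrow> real" where
  "exp_defect t s = exp (- s) * \<bar>(exp s - exp t) / (s - t) - exp t\<bar>
     + \<bar>exp (- s) - exp (- t)\<bar> * exp t
     + \<bar>(exp (- s) - exp (- t)) / (s - t) + exp (- t)\<bar> * exp t"

lemma exp_defect_tendsto: "(exp_defect t \<longlongrightarrow> 0) (at t within S)"
proof -
  have 1: "((\<lambda>s. (exp s - exp t) / (s - t)) \<longlongrightarrow> exp t) (at t within S)"
    using has_field_derivative_at_within[OF DERIV_exp[of t]] by (simp add: has_field_derivative_iff)
  have "((\<lambda>s. exp (- s)) has_field_derivative - exp (- t)) (at t within S)"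
    by (auto intro!: derivative_eq_intros)
  then have 2: "((\<lambda>s. (exp (- s) - exp (- t)) / (s - t)) \<longlongrightarrow> - exp (- t)) (at t within S)"
    by (simp add: has_field_derivative_iff)
  have "((\<lambda>s. exp_defect t s) \<longlongrightarrow> exp (- t) * \<bar>exp t - exp t\<bar>
     + \<bar>exp (- t) - exp (- t)\<bar> * exp t + \<bar>- exp (- t) + exp (- t)\<bar> * exp t) (at t within S)"
    unfolding exp_defect_def by (intro tendsto_intros 1 2)
  then show ?thesis by simp
qed

text \<open>All terms of the exponential series are convex on \<open>[0, \<infinity>)\<close>, so the errors of their difference
  quotients have equal signs and sum to the error for \<open>exp\<close>.\<close>

lemma poisson_quotient_bound:
  assumes st: "0 \<le> s" "0 \<le> t" "s \<noteq> t"
  shows "summable (\<lambda>n. \<bar>poisson_quotient t s n\<bar>)"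
    and "(\<Sum>n. \<bar>poisson_quotient t s n\<bar>) \<le> exp_defect t s"
proof -
  define c where "c r n = r ^ n / fact n" for r :: real and n
  define c' where "c' = shift (c t)"
  define b where "b n = (c s n - c t n) / (s - t) - c' n" for n
  define K where "K = \<bar>exp (- s) - exp (- t)\<bar>"
  define L where "L = \<bar>(exp (- s) - exp (- t)) / (s - t) + exp (- t)\<bar>"
  have cs: "c r sums exp r" for r unfolding c_def by (rule exp_sums_real)
  have c's: "c' sums exp t"
    using shift_sums[of "c t" "\<lambda>_. 1" "exp t"] cs[of t] by (simp add: c'_def)
  have c0: "0 \<le> c t n" "0 \<le> c' n" for n
    using st by (auto simp: c_def c'_def shift_def split: nat.split)
  have bs: "b sums ((exp s - exp t) / (s - t) - exp t)"
    unfolding b_def by (intro sums_diff sums_divide cs c's)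
  have b_sgn: "0 \<le> b n * (s - t)" for n
  proof (cases n)
    case 0
    then show ?thesis by (simp add: b_def c_def c'_def shift_def)
  next
    case (Suc m)
    have "c' n = real (Suc m) * t ^ m / fact (Suc m)"
      by (simp add: Suc c'_def shift_def c_def)
    moreover have "b n * (s - t) = c s n - c t n - c' n * (s - t)"
      unfolding b_def left_diff_distrib[of "_ / _"] using st by simp
    ultimately have "b n * (s - t) = (s ^ Suc m - t ^ Suc m - real (Suc m) * t ^ m * (s - t)) / fact (Suc m)"
      by (simp only: Suc c_def diff_divide_distrib times_divide_eq_left)
    also have "\<dots> \<ge> 0" using power_tangent_le[OF st(1,2), of m] by simp
    finally show ?thesis .
  qed
  have abs_b: "\<bar>b n\<bar> = b n * sgn (s - t)" for n
  proof (cases "t < s")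
    case True
    with b_sgn[of n] have "0 \<le> b n" by (simp add: zero_le_mult_iff)
    with True show ?thesis by simp
  next
    case False
    with st b_sgn[of n] have "b n \<le> 0" by (simp add: zero_le_mult_iff)
    with False st show ?thesis by simp
  qed
  have abs_bs: "(\<lambda>n. \<bar>b n\<bar>) sums (((exp s - exp t) / (s - t) - exp t) * sgn (s - t))"
    unfolding abs_b by (intro sums_mult2 bs)
  define r where "r n = exp (- s) * \<bar>b n\<bar> + K * c' n + L * c t n" for n
  have rs: "r sums (exp (- s) * (((exp s - exp t) / (s - t) - exp t) * sgn (s - t)) + K * exp t + L * exp t)"
    unfolding r_def by (intro sums_add sums_mult abs_bs cs c's)
  have shift_poisson: "shift (poisson t) n = exp (- t) * c' n" for n
    by (simp add: c'_def shift_def c_def poisson_def split: nat.split)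
  \<comment> \<open>Product rule for difference quotients: the power is differenced with exp (- s)
    in front, and the middle term corrects exp (- s) to exp (- t) in front of
    \<open>c'\<close>.\<close>
  have q: "poisson_quotient t s n = exp (- s) * b n + (exp (- s) - exp (- t)) * c' n
      + ((exp (- s) - exp (- t)) / (s - t) + exp (- t)) * c t n" for n
  proof -
    have "(a * x - d * y) / h - (d * z - d * y) = a * ((x - y) / h - z) + (a - d) * z + ((a - d) / h + d) * y"
      for a d h x y z :: real
      unfolding divide_inverse by algebra
    from this[of "exp (- s)" "c s n" "exp (- t)" "c t n" "s - t" "c' n"] show ?thesis
      unfolding poisson_quotient_def shift_poisson poisson_def b_def by (simp only: c_def)
  qed
  have le: "\<bar>poisson_quotient t s n\<bar> \<le> r n" for n
    unfolding q r_def K_def L_def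
    by (intro order_trans[OF abs_triangle_ineq] add_mono) (auto simp: abs_mult c0)
  show sq: "summable (\<lambda>n. \<bar>poisson_quotient t s n\<bar>)"
    by (rule summable_comparison_test'[OF sums_summable[OF rs]]) (simp add: le)
  have "(\<Sum>n. \<bar>poisson_quotient t s n\<bar>) \<le> suminf r"
    by (intro suminf_le le sq sums_summable[OF rs])
  also have "\<dots> = exp (- s) * (((exp s - exp t) / (s - t) - exp t) * sgn (s - t)) + K * exp t + L * exp t"
    using rs by (rule sums_unique[symmetric])
  also have "\<dots> \<le> exp_defect t s"
    unfolding exp_defect_def K_def L_def
    by (intro add_mono mult_left_mono order_refl) (auto simp: sgn_if)
  finally show "(\<Sum>n. \<bar>poisson_quotient t s n\<bar>) \<le> exp_defect t s" .
qed

subsection \<open>Differentiable curves\<close>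

lemma Lp_tendsto_ae_cong:
  assumes p: "1 \<le> p" and u: "Lp_tendsto p u f F" and "\<forall>\<^sub>F s in F. u s \<in> Lp p" "f \<in> Lp p" and eq: "ae_eq f g"
  shows "Lp_tendsto p u g F"
proof (rule Lp_tendstoI)
  show "((\<lambda>s. Lp_norm p (\<lambda>x. u s x - f x)) \<longlongrightarrow> 0) F"
    using u by (simp add: Lp_tendsto_def)
  show "\<forall>\<^sub>F s in F. (\<lambda>x. u s x - g x) \<in> Lp_cball p (Lp_norm p (\<lambda>x. u s x - f x))"
    using assms(3)
  proof eventually_elim
    case (elim s)
    have "(\<lambda>x. u s x - f x) \<in> Lp_cball p (Lp_norm p (\<lambda>x. u s x - f x))"
      by (intro Lp_cball_norm Lp_diff p elim assms)
    then show ?case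
      by (rule Lp_cball_ae_eq[OF p _ ae_eq_diff[OF ae_eq_refl eq]])
  qed
qed

lemma Lp_tendsto_L1:
  assumes p: "1 \<le> p" and u: "Lp_tendsto p u f F" and "\<forall>\<^sub>F s in F. u s \<in> Lp p" "f \<in> Lp p"
  shows "((\<lambda>s. LINT x|unit_leb. \<bar>u s x - f x\<bar>) \<longlongrightarrow> 0) F"
proof (rule tendsto_sandwich[OF _ _ tendsto_const])
  show "((\<lambda>s. 2 * Lp_norm p (\<lambda>x. u s x - f x)) \<longlongrightarrow> 0) F"
    using u unfolding Lp_tendsto_def by (rule tendsto_mult_right_zero)
  show "\<forall>\<^sub>F s in F. (LINT x|unit_leb. \<bar>u s x - f x\<bar>) \<le> 2 * Lp_norm p (\<lambda>x. u s x - f x)"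
    using assms(3) by (rule eventually_mono) (intro Lp_cball_L1(2)[OF p] Lp_cball_norm Lp_diff p assms)
qed simp

lemma Lp_quotient: "1 \<le> p \<Longrightarrow> f \<in> Lp p \<Longrightarrow> g \<in> Lp p \<Longrightarrow> (\<lambda>x. (f x - g x) / c) \<in> Lp p"
  using Lp_scale[OF _ Lp_diff, of p f g "1 / c"] by simp

lemma eventually_at_within_mem: "\<forall>\<^sub>F s in at t within J. s \<in> J \<and> s \<noteq> t"
  by (simp add: eventually_at_filter)

lemma Lp_has_derivative_on_diff:
  assumes p: "1 \<le> p" and u: "Lp_has_derivative_on p J u u'" and v: "Lp_has_derivative_on p J v v'"
  shows "Lp_has_derivative_on p J (\<lambda>s x. u s x - v s x) (\<lambda>s x. u' s x - v' s x)"
  unfolding Lp_has_derivative_on_def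
proof (intro ballI conjI)
  fix t assume t: "t \<in> J"
  have mem: "u s \<in> Lp p" "v s \<in> Lp p" "u' s \<in> Lp p" "v' s \<in> Lp p" if "s \<in> J" for s
    using u v that by (auto simp: Lp_has_derivative_on_def)
  show "(\<lambda>x. u t x - v t x) \<in> Lp p" "(\<lambda>x. u' t x - v' t x) \<in> Lp p"
    using mem[OF t] by (auto intro: Lp_diff[OF p])
  let ?q = "\<lambda>w w' s x. (w s x - w t x) / (s - t) - w' t x"
  show "Lp_tendsto p (\<lambda>s x. (u s x - v s x - (u t x - v t x)) / (s - t)) (\<lambda>x. u' t x - v' t x) (at t within J)"
  proof (rule Lp_tendstoI)
    show "((\<lambda>s. Lp_norm p (?q u u' s) + Lp_norm p (?q v v' s)) \<longlongrightarrow> 0) (at t within J)"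
      using u v t by (intro tendsto_add_zero) (auto simp: Lp_has_derivative_on_def Lp_tendsto_def)
    show "\<forall>\<^sub>F s in at t within J.
        (\<lambda>x. (u s x - v s x - (u t x - v t x)) / (s - t) - (u' t x - v' t x))
          \<in> Lp_cball p (Lp_norm p (?q u u' s) + Lp_norm p (?q v v' s))"
      using eventually_at_within_mem
    proof eventually_elim
      case (elim s)
      have "(\<lambda>x. ?q u u' s x - ?q v v' s x) \<in> Lp_cball p (Lp_norm p (?q u u' s) + Lp_norm p (?q v v' s))"
        using mem[OF t] mem[of s] elim
        by (intro Lp_cball_diff[OF p] Lp_cball_norm Lp_diff[OF p] Lp_quotient[OF p]) auto
      moreover have "(u s x - v s x - (u t x - v t x)) / (s - t) - (u' t x - v' t x) = ?q u u' s x - ?q v v' s x" for x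
        by (simp add: diff_divide_distrib)
      ultimately show ?case by (simp only:)
    qed
  qed
qed

text \<open>This reduces curves in L^p to real functions, to which the mean value theorem applies. A
  bounded \<open>g\<close> suffices because convergence in L^p implies convergence in L^1.\<close>

lemma Lp_has_derivative_on_pairing:
  assumes p: "1 \<le> p" and u: "Lp_has_derivative_on p J u u'" and t: "t \<in> J"
    and g [measurable]: "g \<in> borel_measurable unit_leb" and g1: "\<And>x. \<bar>g x\<bar> \<le> 1"
  shows "((\<lambda>s. LINT x|unit_leb. u s x * g x) has_real_derivative (LINT x|unit_leb. u' t x * g x)) (at t within J)"
proof -
  have mem: "u s \<in> Lp p" "u' s \<in> Lp p" if "s \<in> J" for s
    using u that by (auto simp: Lp_has_derivative_on_def)
  let ?Q = "\<lambda>s x. (u s x - u t x) / (s - t)"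
  have Q: "\<forall>\<^sub>F s in at t within J. ?Q s \<in> Lp p"
    using eventually_at_within_mem by (rule eventually_mono) (use t in \<open>auto intro!: Lp_quotient[OF p] mem\<close>)
  have lim: "((\<lambda>s. LINT x|unit_leb. \<bar>?Q s x - u' t x\<bar>) \<longlongrightarrow> 0) (at t within J)"
    using u t by (intro Lp_tendsto_L1[OF p _ Q mem(2)]) (auto simp: Lp_has_derivative_on_def)
  have int: "integrable unit_leb (\<lambda>x. f x * g x)" if "f \<in> Lp p" for f
  proof (rule Bochner_Integration.integrable_bound[OF Lp_integrable[OF p that]])
    show "(\<lambda>x. f x * g x) \<in> borel_measurable unit_leb" using Lp_measurable[OF that] by measurable
    show "AE x in unit_leb. norm (f x * g x) \<le> norm (f x)"
      by (simp add: abs_mult mult_left_le g1)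
  qed
  have "((\<lambda>s. ((LINT x|unit_leb. u s x * g x) - (LINT x|unit_leb. u t x * g x)) / (s - t)
      - (LINT x|unit_leb. u' t x * g x)) \<longlongrightarrow> 0) (at t within J)"
  proof (rule Lim_null_comparison[OF _ lim])
    show "\<forall>\<^sub>F s in at t within J. norm (((LINT x|unit_leb. u s x * g x) - (LINT x|unit_leb. u t x * g x)) / (s - t)
      - (LINT x|unit_leb. u' t x * g x)) \<le> (LINT x|unit_leb. \<bar>?Q s x - u' t x\<bar>)"
      using eventually_at_within_mem
    proof eventually_elim
      case (elim s)
      have D: "(\<lambda>x. ?Q s x - u' t x) \<in> Lp p"
        using mem[OF t] mem[of s] elim by (intro Lp_diff[OF p] Lp_quotient[OF p]) auto
      have "((LINT x|unit_leb. u s x * g x) - (LINT x|unit_leb. u t x * g x)) / (s - t)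
          - (LINT x|unit_leb. u' t x * g x) = (LINT x|unit_leb. (u s x * g x - u t x * g x) / (s - t) - u' t x * g x)"
        using mem[OF t] mem[of s] elim by (simp add: int)
      also have "\<dots> = (LINT x|unit_leb. (?Q s x - u' t x) * g x)"
        by (simp add: left_diff_distrib)
      also have "norm \<dots> \<le> (LINT x|unit_leb. \<bar>?Q s x - u' t x\<bar>)"
      proof (rule order_trans[OF integral_norm_bound integral_mono])
        show "integrable unit_leb (\<lambda>x. norm ((?Q s x - u' t x) * g x))"
          by (intro integrable_norm int D)
        show "integrable unit_leb (\<lambda>x. \<bar>?Q s x - u' t x\<bar>)" using Lp_integrable[OF p D] by simp
        show "norm ((?Q s x - u' t x) * g x) \<le> \<bar>?Q s x - u' t x\<bar>" for x
          by (simp add: abs_mult mult_left_le g1 del: times_divide_eq_left)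
      qed
      finally show ?case .
    qed
  qed
  then show ?thesis
    unfolding has_field_derivative_iff by (rule Lim_null[THEN iffD2])
qed

lemma Lp_has_derivative_on_L1_continuous:
  assumes p: "1 \<le> p" and u: "Lp_has_derivative_on p J u u'"
  shows "continuous_on J (\<lambda>s. LINT x|unit_leb. \<bar>u s x\<bar>)"
  unfolding continuous_on_def
proof
  fix t assume t: "t \<in> J"
  have mem: "u s \<in> Lp p" "u' s \<in> Lp p" if "s \<in> J" for s
    using u that by (auto simp: Lp_has_derivative_on_def)
  let ?Q = "\<lambda>s x. (u s x - u t x) / (s - t)"
  have Q: "\<forall>\<^sub>F s in at t within J. ?Q s \<in> Lp p"
    using eventually_at_within_mem by (rule eventually_mono) (use t in \<open>auto intro!: Lp_quotient[OF p] mem\<close>)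
  have lim: "((\<lambda>s. LINT x|unit_leb. \<bar>?Q s x - u' t x\<bar>) \<longlongrightarrow> 0) (at t within J)"
    using u t by (intro Lp_tendsto_L1[OF p _ Q mem(2)]) (auto simp: Lp_has_derivative_on_def)
  \<comment> \<open>u s - u t is s - t times the quotient, and the quotient is \<open>u' t\<close>
    up to an error tending to 0 in L^1.\<close>
  let ?d = "\<lambda>s. \<bar>s - t\<bar> * ((LINT x|unit_leb. \<bar>?Q s x - u' t x\<bar>) + (LINT x|unit_leb. \<bar>u' t x\<bar>))"
  have "(?d \<longlongrightarrow> \<bar>t - t\<bar> * (0 + (LINT x|unit_leb. \<bar>u' t x\<bar>))) (at t within J)"
    by (intro tendsto_intros lim)
  then have d: "(?d \<longlongrightarrow> 0) (at t within J)" by simp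
  show "((\<lambda>s. LINT x|unit_leb. \<bar>u s x\<bar>) \<longlongrightarrow> (LINT x|unit_leb. \<bar>u t x\<bar>)) (at t within J)"
  proof (rule Lim_null[THEN iffD2], rule Lim_null_comparison[OF _ d])
    show "\<forall>\<^sub>F s in at t within J. norm ((LINT x|unit_leb. \<bar>u s x\<bar>) - (LINT x|unit_leb. \<bar>u t x\<bar>)) \<le> ?d s"
      using eventually_at_within_mem
    proof eventually_elim
      case (elim s)
      have D: "integrable unit_leb (\<lambda>x. ?Q s x - u' t x)" "integrable unit_leb (u s)"
          "integrable unit_leb (u t)" "integrable unit_leb (u' t)"
        using mem[OF t] mem[of s] elim
        by (intro Lp_integrable[OF p] Lp_diff[OF p] Lp_quotient[OF p]; auto)+
      have "norm ((LINT x|unit_leb. \<bar>u s x\<bar>) - (LINT x|unit_leb. \<bar>u t x\<bar>)) = norm (LINT x|unit_leb. \<bar>u s x\<bar> - \<bar>u t x\<bar>)"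
        using D by simp
      also have "\<dots> \<le> (LINT x|unit_leb. \<bar>s - t\<bar> * (\<bar>?Q s x - u' t x\<bar> + \<bar>u' t x\<bar>))"
      proof (rule order_trans[OF integral_norm_bound integral_mono])
        fix x
        have "\<bar>\<bar>u s x\<bar> - \<bar>u t x\<bar>\<bar> \<le> \<bar>u s x - u t x\<bar>" by (rule abs_triangle_ineq3)
        also have "\<dots> = \<bar>s - t\<bar> * \<bar>?Q s x\<bar>" using elim by (simp add: abs_divide)
        also have "\<dots> \<le> \<bar>s - t\<bar> * (\<bar>?Q s x - u' t x\<bar> + \<bar>u' t x\<bar>)"
          by (rule mult_left_mono) arith+
        finally show "norm (\<bar>u s x\<bar> - \<bar>u t x\<bar>) \<le> \<bar>s - t\<bar> * (\<bar>?Q s x - u' t x\<bar> + \<bar>u' t x\<bar>)" by simp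
      qed (use D in auto)
      also have "\<dots> = ?d s" using D by simp
      finally show ?case .
    qed
  qed
qed

subsection \<open>The Markov operator of a symmetric kernel\<close>

lemma id_measurable_unit_leb [measurable]: "(\<lambda>x. x) \<in> measurable unit_leb borel"
  by (intro measurable_restrict_space1 measurable_completion) simp

text \<open>The conditions hold at every point, so all sections are measurable and Tonelli's theorem
  applies without exceptional sets. \<open>V_degree\<close> bounds a nonnegative integral, which
  cannot hide a divergent degree behind a default value.\<close>

locale symmetric_kernel =
  fixes V :: "real \<Rightarrow> real \<Rightarrow> real"
  assumes V_borel: "(\<lambda>(x, y). V x y) \<in> borel_measurable (borel \<Otimes>\<^sub>M borel)"
    and V_nonneg: "0 \<le> V x y"
    and V_sym: "V x y = V y x"
    and V_degree: "(\<integral>\<^sup>+y. ennreal (V x y) \<partial>unit_leb) \<le> 1"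
begin

sublocale pair: pair_sigma_finite unit_leb unit_leb ..

lemma V_measurable [measurable]:
  assumes [measurable]: "f \<in> measurable M borel" "g \<in> measurable M borel"
  shows "(\<lambda>z. V (f z) (g z)) \<in> borel_measurable M"
proof -
  have "(\<lambda>z. (f z, g z)) \<in> measurable M (borel \<Otimes>\<^sub>M borel)" by measurable
  from measurable_compose[OF this V_borel] show ?thesis by simp
qed

definition deg :: "real \<Rightarrow> real" where
  "deg x = (LINT y|unit_leb. V x y)"

text \<open>The mass 1 - deg x missing from the kernel stays at x, as in a lazy random walk: the
  total mass is 1, and subtracting \<open>f\<close> leaves the diffusion operator of
  \<open>V\<close>.\<close>

definition markov :: "(real \<Rightarrow> real) \<Rightarrow> real \<Rightarrow> real" where
  "markov f x = (LINT y|unit_leb. V x y * f y) + (1 - deg x) * f x"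

text \<open>On [0, \<infinity>]-valued functions invariance and monotonicity need no integrability;
  \<open>markov_AE\<close> transfers the resulting bounds to \<open>markov\<close>.\<close>

definition nn_markov :: "(real \<Rightarrow> ennreal) \<Rightarrow> real \<Rightarrow> ennreal" where
  "nn_markov f x = (\<integral>\<^sup>+y. ennreal (V x y) * f y \<partial>unit_leb) + ennreal (1 - deg x) * f x"

lemma integrable_V: "integrable unit_leb (V x)"
proof (rule integrableI_bounded)
  show "V x \<in> borel_measurable unit_leb" by measurable
  show "(\<integral>\<^sup>+y. ennreal (norm (V x y)) \<partial>unit_leb) < \<infinity>"
    using le_less_trans[OF V_degree[of x], of \<infinity>] by (simp add: V_nonneg)
qed

lemma ennreal_deg: "ennreal (deg x) = (\<integral>\<^sup>+y. ennreal (V x y) \<partial>unit_leb)"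
  unfolding deg_def using integrable_V[of x] V_nonneg
  by (subst nn_integral_eq_integral) auto

lemma deg_nonneg: "0 \<le> deg x"
  unfolding deg_def by (simp add: V_nonneg)

lemma deg_le_1: "deg x \<le> 1"
  using V_degree[of x] unfolding ennreal_deg[symmetric] by simp

lemma deg_measurable [measurable]: "deg \<in> borel_measurable unit_leb"
  unfolding deg_def by measurable

lemma markov_measurable:
  assumes [measurable]: "f \<in> borel_measurable unit_leb"
  shows "markov f \<in> borel_measurable unit_leb"
  unfolding markov_def by measurable

lemma nn_markov_measurable [measurable]:
  assumes [measurable]: "f \<in> borel_measurable unit_leb"
  shows "nn_markov f \<in> borel_measurable unit_leb"
  unfolding nn_markov_def by measurable

lemma deg_split: "ennreal (deg x) + ennreal (1 - deg x) = 1"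
  using deg_nonneg[of x] deg_le_1[of x]
  by (simp add: ennreal_plus[symmetric] del: ennreal_plus)

lemma nn_markov_const: "nn_markov (\<lambda>y. c) x = c"
  unfolding nn_markov_def
  by (simp add: nn_integral_multc ennreal_deg[symmetric] distrib_right[symmetric] deg_split)

lemma nn_markov_add:
  assumes [measurable]: "f \<in> borel_measurable unit_leb" "g \<in> borel_measurable unit_leb"
  shows "nn_markov (\<lambda>y. f y + g y) x = nn_markov f x + nn_markov g x"
  unfolding nn_markov_def by (simp add: distrib_left nn_integral_add add.assoc add.left_commute)

lemma nn_markov_cmult:
  assumes [measurable]: "f \<in> borel_measurable unit_leb"
  shows "nn_markov (\<lambda>y. c * f y) x = c * nn_markov f x"
  unfolding nn_markov_def by (simp add: distrib_left nn_integral_cmult mult.left_commute)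

text \<open>The inequality at x is asked separately: the transition measure has an atom at x, which
  an almost everywhere statement does not see.\<close>

lemma nn_markov_mono_AE:
  assumes "AE y in unit_leb. f y \<le> g y" "f x \<le> g x"
  shows "nn_markov f x \<le> nn_markov g x"
  unfolding nn_markov_def using assms
  by (intro add_mono nn_integral_mono_AE mult_left_mono) (auto elim!: eventually_mono intro: mult_left_mono)

text \<open>Lebesgue measure is invariant under the Markov operator, because \<open>V\<close> is symmetric.\<close>

lemma nn_integral_nn_markov:
  assumes [measurable]: "f \<in> borel_measurable unit_leb"
  shows "(\<integral>\<^sup>+x. nn_markov f x \<partial>unit_leb) = (\<integral>\<^sup>+x. f x \<partial>unit_leb)"
proof -
  have "(\<integral>\<^sup>+x. \<integral>\<^sup>+y. ennreal (V x y) * f y \<partial>unit_leb \<partial>unit_leb) =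
      (\<integral>\<^sup>+y. \<integral>\<^sup>+x. ennreal (V x y) * f y \<partial>unit_leb \<partial>unit_leb)"
    by (rule pair.Fubini'[symmetric]) measurable
  also have "\<dots> = (\<integral>\<^sup>+y. ennreal (deg y) * f y \<partial>unit_leb)"
    by (simp add: nn_integral_multc V_sym[of _ y for y] ennreal_deg)
  finally have "(\<integral>\<^sup>+x. nn_markov f x \<partial>unit_leb) =
      (\<integral>\<^sup>+x. ennreal (deg x) * f x + ennreal (1 - deg x) * f x \<partial>unit_leb)"
    unfolding nn_markov_def by (simp add: nn_integral_add)
  then show ?thesis
    by (simp add: distrib_right[symmetric] deg_split)
qed

lemma markov_AE:
  assumes f: "integrable unit_leb f"
  shows "AE x in unit_leb. integrable unit_leb (\<lambda>y. V x y * f y) \<and>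
    ennreal \<bar>markov f x\<bar> \<le> nn_markov (\<lambda>y. ennreal \<bar>f y\<bar>) x"
proof -
  have [measurable]: "f \<in> borel_measurable unit_leb" using f by auto
  have "(\<integral>\<^sup>+x. nn_markov (\<lambda>y. ennreal \<bar>f y\<bar>) x \<partial>unit_leb) < \<infinity>"
    using f by (simp add: nn_integral_nn_markov integrable_iff_bounded)
  \<comment> \<open>By invariance the integral of \<open>nn_markov\<close> is that of \<bar>f\<bar>,
    hence finite, so almost every section is integrable.\<close>
  then have "AE x in unit_leb. nn_markov (\<lambda>y. ennreal \<bar>f y\<bar>) x \<noteq> \<infinity>"
    by (intro nn_integral_PInf_AE) auto
  then show ?thesis
  proof eventually_elim
    case (elim x)
    have eq: "(\<integral>\<^sup>+y. ennreal (norm (V x y * f y)) \<partial>unit_leb) =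
        (\<integral>\<^sup>+y. ennreal (V x y) * ennreal \<bar>f y\<bar> \<partial>unit_leb)"
      by (simp add: abs_mult V_nonneg ennreal_mult)
    have int: "integrable unit_leb (\<lambda>y. V x y * f y)"
    proof (rule integrableI_bounded)
      show "(\<integral>\<^sup>+y. ennreal (norm (V x y * f y)) \<partial>unit_leb) < \<infinity>"
        using elim unfolding eq nn_markov_def by (simp add: less_top)
    qed measurable
    have "\<bar>markov f x\<bar> \<le> norm (LINT y|unit_leb. V x y * f y) + (1 - deg x) * \<bar>f x\<bar>"
      unfolding markov_def using deg_le_1[of x]
      by (intro order_trans[OF abs_triangle_ineq]) (simp add: abs_mult)
    also have "\<dots> \<le> (LINT y|unit_leb. norm (V x y * f y)) + (1 - deg x) * \<bar>f x\<bar>"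
      using integral_norm_bound by (intro add_right_mono) blast
    finally have "ennreal \<bar>markov f x\<bar> \<le>
        ennreal ((LINT y|unit_leb. norm (V x y * f y)) + (1 - deg x) * \<bar>f x\<bar>)"
      by (rule ennreal_leI)
    also have "\<dots> = ennreal (LINT y|unit_leb. norm (V x y * f y)) + ennreal (1 - deg x) * ennreal \<bar>f x\<bar>"
      using deg_le_1[of x] by (subst ennreal_plus) (auto simp: ennreal_mult)
    also have "ennreal (LINT y|unit_leb. norm (V x y * f y)) = (\<integral>\<^sup>+y. ennreal (V x y) * ennreal \<bar>f y\<bar> \<partial>unit_leb)"
      using nn_integral_eq_integral[of unit_leb "\<lambda>y. norm (V x y * f y)"] int eq by simp
    finally have "ennreal \<bar>markov f x\<bar> \<le> nn_markov (\<lambda>y. ennreal \<bar>f y\<bar>) x"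
      unfolding nn_markov_def .
    with int show ?case by simp
  qed
qed

lemma markov_L1_le:
  assumes f: "integrable unit_leb f"
  shows "(LINT x|unit_leb. \<bar>markov f x\<bar>) \<le> (LINT x|unit_leb. \<bar>f x\<bar>)"
proof -
  have [measurable]: "f \<in> borel_measurable unit_leb" using f by auto
  have "(\<integral>\<^sup>+x. ennreal \<bar>markov f x\<bar> \<partial>unit_leb) \<le> (\<integral>\<^sup>+x. nn_markov (\<lambda>y. ennreal \<bar>f y\<bar>) x \<partial>unit_leb)"
    using markov_AE[OF f] by (intro nn_integral_mono_AE) (auto elim: eventually_mono)
  also have "\<dots> = (\<integral>\<^sup>+x. ennreal \<bar>f x\<bar> \<partial>unit_leb)"
    by (simp add: nn_integral_nn_markov)
  also have "\<dots> = ennreal (LINT x|unit_leb. \<bar>f x\<bar>)"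
    using f by (intro nn_integral_eq_integral) auto
  finally show ?thesis
    by (intro integral_real_bounded) (auto simp: markov_measurable)
qed

text \<open>Jensen's inequality for the probability measures \<open>V x y dy + (1 - deg x) \<delta>\<^sub>x(dy)\<close>,
  obtained by integrating Young's inequality with \<open>m = \<bar>markov f x\<bar>\<close>.\<close>

lemma markov_powr_le:
  assumes r: "1 \<le> r" and f[measurable]: "f \<in> borel_measurable unit_leb"
    and le: "ennreal \<bar>markov f x\<bar> \<le> nn_markov (\<lambda>y. ennreal \<bar>f y\<bar>) x"
  shows "ennreal (\<bar>markov f x\<bar> powr r) \<le> nn_markov (\<lambda>y. ennreal (\<bar>f y\<bar> powr r)) x"
proof -
  define m where "m = \<bar>markov f x\<bar>"
  have m0: "0 \<le> m" by (simp add: m_def)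
  \<comment> \<open>The tangent to z powr r at m, obtained from Young's inequality with weights 1 /
    r and 1 - 1 / r for z powr r and m powr r.\<close>
  have young: "r * m powr (r - 1) * z \<le> z powr r + (r - 1) * m powr r" if "0 \<le> z" for z
  proof (cases "m = 0 \<or> z = 0")
    case True
    then show ?thesis using r by auto
  next
    case False
    then have "(z powr r) powr (1 / r) * (m powr r) powr (1 - 1 / r) \<le>
        (1 / r) * z powr r + (1 - 1 / r) * m powr r"
      using r that m0 by (intro Youngs_inequality_0) auto
    then have "r * (z * m powr (r - 1)) \<le> r * ((1 / r) * z powr r + (1 - 1 / r) * m powr r)"
      using r that m0 by (intro mult_left_mono) (auto simp: powr_powr right_diff_distrib)
    also have "\<dots> = z powr r + (r - 1) * m powr r"
      using r by (simp add: field_simps)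
    finally show ?thesis by (simp add: mult_ac)
  qed
  have mr: "m powr (r - 1) * m = m powr r"
    using m0 by (cases "m = 0") (auto simp: powr_mult_base mult.commute)
  have "ennreal (r * m powr r) = ennreal (r * m powr (r - 1)) * ennreal m"
    using r m0 mr by (simp add: ennreal_mult[symmetric] mult.assoc)
  also have "\<dots> \<le> ennreal (r * m powr (r - 1)) * nn_markov (\<lambda>y. ennreal \<bar>f y\<bar>) x"
    using le by (intro mult_left_mono) (auto simp: m_def)
  also have "\<dots> = nn_markov (\<lambda>y. ennreal (r * m powr (r - 1)) * ennreal \<bar>f y\<bar>) x"
    by (simp add: nn_markov_cmult)
  also have "\<dots> \<le> nn_markov (\<lambda>y. ennreal (\<bar>f y\<bar> powr r) + ennreal ((r - 1) * m powr r)) x"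
  proof -
    have "ennreal (r * m powr (r - 1)) * ennreal \<bar>f y\<bar> \<le>
        ennreal (\<bar>f y\<bar> powr r) + ennreal ((r - 1) * m powr r)" for y
      using r young[of "\<bar>f y\<bar>"]
      by (simp add: ennreal_mult[symmetric] ennreal_plus[symmetric] ennreal_leI del: ennreal_plus)
    then show ?thesis by (intro nn_markov_mono_AE) auto
  qed
  also have "\<dots> = nn_markov (\<lambda>y. ennreal (\<bar>f y\<bar> powr r)) x + ennreal ((r - 1) * m powr r)"
    by (simp add: nn_markov_add nn_markov_const)
  finally have "ennreal (r * m powr r) \<le>
      nn_markov (\<lambda>y. ennreal (\<bar>f y\<bar> powr r)) x + ennreal ((r - 1) * m powr r)" .
  moreover have "ennreal (m powr r + (r - 1) * m powr r) = ennreal (m powr r) + ennreal ((r - 1) * m powr r)"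
    using r by (intro ennreal_plus) auto
  moreover have "m powr r + (r - 1) * m powr r = r * m powr r" by (simp add: left_diff_distrib)
  \<comment> \<open>The term (r - 1) * m powr r is finite, so it cancels in [0, \<infinity>] and
    leaves m powr r.\<close>
  ultimately have "ennreal ((r - 1) * m powr r) + ennreal (m powr r) \<le>
      ennreal ((r - 1) * m powr r) + nn_markov (\<lambda>y. ennreal (\<bar>f y\<bar> powr r)) x"
    by (simp add: add.commute)
  then show ?thesis
    unfolding ennreal_add_left_cancel_le by (simp add: m_def)
qed

lemma markov_cball:
  assumes p: "1 \<le> p" and f: "f \<in> Lp_cball p C"
  shows "markov f \<in> Lp_cball p C"
proof (cases p)
  case (real r)
  with p have r: "1 \<le> r" by simp
  have C: "0 \<le> C" and m [measurable]: "f \<in> borel_measurable unit_leb" using f by (auto dest: Lp_cballD)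
  have "(\<integral>\<^sup>+x. ennreal (\<bar>markov f x\<bar> powr r) \<partial>unit_leb) \<le>
      (\<integral>\<^sup>+x. nn_markov (\<lambda>y. ennreal (\<bar>f y\<bar> powr r)) x \<partial>unit_leb)"
    by (intro nn_integral_mono_AE eventually_mono[OF markov_AE[OF Lp_cball_L1(1)[OF p f]]])
      (auto intro: markov_powr_le[OF r m])
  also have "\<dots> = (\<integral>\<^sup>+x. ennreal (\<bar>f x\<bar> powr r) \<partial>unit_leb)"
    by (simp add: nn_integral_nn_markov)
  also have "\<dots> \<le> ennreal (C powr r)" using f r C by (simp add: real Lp_cball_real)
  finally show ?thesis using r C by (simp add: real Lp_cball_real markov_measurable)
next
  case PInf
  have C: "0 \<le> C" and m [measurable]: "f \<in> borel_measurable unit_leb" using f by (auto dest: Lp_cballD)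
  have fC: "AE x in unit_leb. ennreal \<bar>f x\<bar> \<le> ennreal C"
    using f C by (auto simp: PInf Lp_cball_infinity elim!: eventually_mono intro: ennreal_leI)
  have "AE x in unit_leb. \<bar>markov f x\<bar> \<le> C"
    using fC markov_AE[OF Lp_cball_L1(1)[OF p f]]
  proof eventually_elim
    case (elim x)
    then have "ennreal \<bar>markov f x\<bar> \<le> nn_markov (\<lambda>y. ennreal \<bar>f y\<bar>) x" by simp
    also have "\<dots> \<le> nn_markov (\<lambda>y. ennreal C) x"
      using fC elim(1) by (rule nn_markov_mono_AE)
    finally show ?case using C by (simp add: nn_markov_const)
  qed
  then show ?thesis using C by (simp add: PInf Lp_cball_infinity markov_measurable)
qed (use p in auto)

lemma markov_add:
  assumes "integrable unit_leb f" "integrable unit_leb g"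
  shows "ae_eq (markov (\<lambda>x. f x + g x)) (\<lambda>x. markov f x + markov g x)"
  using markov_AE[OF assms(1)] markov_AE[OF assms(2)] unfolding ae_eq_def
  by eventually_elim (simp add: markov_def algebra_simps)

lemma markov_scale: "markov (\<lambda>x. c * f x) = (\<lambda>x. c * markov f x)"
  by (rule ext) (simp add: markov_def distrib_left mult.left_commute)

lemma markov_diffusion:
  assumes "integrable unit_leb f"
  shows "AE x in unit_leb. (LINT y|unit_leb. V x y * (f y - f x)) = markov f x - f x"
  using markov_AE[OF assms]
proof eventually_elim
  case (elim x)
  then have "(LINT y|unit_leb. V x y * (f y - f x)) =
      (LINT y|unit_leb. V x y * f y) - (LINT y|unit_leb. V x y * f x)"
    using integrable_V[of x] by (simp add: right_diff_distrib)
  then show ?case by (simp add: markov_def deg_def left_diff_distrib)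
qed

end

subsection \<open>The semigroup generated by \<open>B - I\<close>\<close>

context Lp_contraction
begin

definition heat :: "real \<Rightarrow> (real \<Rightarrow> real) \<Rightarrow> real \<Rightarrow> real" where
  "heat t = ser (poisson t)"

lemma heat_cball: "0 \<le> t \<Longrightarrow> f \<in> Lp_cball p C \<Longrightarrow> heat t f \<in> Lp_cball p C"
  using ser_cball[OF summable_abs_poisson, of t f C] abs_poisson_sums[of t]
  by (simp add: heat_def sums_iff)

lemma heat_linear: "0 \<le> t \<Longrightarrow> Lp_bounded_linear p (heat t)"
  unfolding heat_def by (intro ser_linear summable_abs_poisson)

lemma heat_Lp: "0 \<le> t \<Longrightarrow> f \<in> Lp p \<Longrightarrow> heat t f \<in> Lp p"
  by (rule Lp_bounded_linearD(1)[OF heat_linear])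

lemma heat_0: "heat 0 f = f"
proof
  fix x
  have "heat 0 f x = (\<Sum>n\<in>{0::nat}. poisson 0 n * (B ^^ n) f x)"
    unfolding heat_def ser_def by (rule suminf_finite) (auto simp: poisson_0)
  then show "heat 0 f x = f x" by (simp add: poisson_0)
qed

lemma generator_Lp: "f \<in> Lp p \<Longrightarrow> (\<lambda>x. B f x - f x) \<in> Lp p"
  by (intro Lp_diff[OF p] Lp_bounded_linearD(1)[OF B_linear])

text \<open>Because \<open>B\<close> is a contraction, \<open>ser\<close> is bounded by 1 from l^1
  to operators. Differentiating \<open>heat\<close> thus reduces to the l^1 error of the Poisson
  weights.\<close>

lemma heat_tendsto:
  assumes t: "0 \<le> t" and f: "f \<in> Lp p"
  shows "Lp_tendsto p (\<lambda>s x. (heat s f x - heat t f x) / (s - t)) (\<lambda>x. B (heat t f) x - heat t f x) (at t within {0..})"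
proof (rule Lp_tendstoI)
  show "((\<lambda>s. exp_defect t s * Lp_norm p f) \<longlongrightarrow> 0) (at t within {0..})"
    by (intro tendsto_mult_left_zero exp_defect_tendsto)
  show "\<forall>\<^sub>F s in at t within {0..}. (\<lambda>x. (heat s f x - heat t f x) / (s - t) - (B (heat t f) x - heat t f x))
      \<in> Lp_cball p (exp_defect t s * Lp_norm p f)"
    using eventually_at_within_mem
  proof eventually_elim
    case (elim s)
    then have s: "0 \<le> s" "s \<noteq> t" by auto
    note sm = summable_abs_poisson[OF s(1)] summable_abs_poisson[OF t]
      summable_abs_shift[OF summable_abs_poisson[OF t]]
    \<comment> \<open>\<open>?b\<close> holds the coefficients of the difference quotient and
      \<open>?c\<close> those of minus the derivative; \<open>ser_shift\<close> and
      \<open>B_ser\<close> turn the shifted weights into \<open>B\<close> after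
      \<open>heat t\<close>.\<close>
    let ?b = "\<lambda>n. (1 / (s - t)) * poisson s n + (- 1 / (s - t)) * poisson t n"
    let ?c = "\<lambda>n. (- 1) * shift (poisson t) n + 1 * poisson t n"
    have summ: "summable (\<lambda>n. \<bar>k * a n + l * b n\<bar>)"
      if "summable (\<lambda>n. \<bar>a n\<bar>)" "summable (\<lambda>n. \<bar>b n\<bar>)" for k l :: real and a b :: "nat \<Rightarrow> real"
    proof (rule summable_comparison_test')
      show "summable (\<lambda>n. \<bar>k\<bar> * \<bar>a n\<bar> + \<bar>l\<bar> * \<bar>b n\<bar>)"
        by (intro summable_add summable_mult that)
      show "norm \<bar>k * a n + l * b n\<bar> \<le> \<bar>k\<bar> * \<bar>a n\<bar> + \<bar>l\<bar> * \<bar>b n\<bar>" if "0 \<le> n" for n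
        using abs_triangle_ineq[of "k * a n" "l * b n"] by (simp add: abs_mult)
    qed
    have q: "poisson_quotient t s = (\<lambda>n. 1 * ?b n + 1 * ?c n)"
      using s by (auto simp: poisson_quotient_def diff_divide_distrib)
    have "ser (poisson_quotient t s) f \<in> Lp_cball p ((\<Sum>n. \<bar>poisson_quotient t s n\<bar>) * Lp_norm p f)"
      by (intro ser_cball poisson_quotient_bound s t Lp_cball_norm f)
    then have "ser (poisson_quotient t s) f \<in> Lp_cball p (exp_defect t s * Lp_norm p f)"
      by (rule Lp_cball_mono) (intro mult_right_mono poisson_quotient_bound s t Lp_norm_nonneg)
    moreover have "ae_eq (ser (poisson_quotient t s) f)
        (\<lambda>x. (heat s f x - heat t f x) / (s - t) - (B (heat t f) x - heat t f x))"
      using ser_lincomb[OF summ[OF sm(1,2)] summ[OF sm(3,2)] f, of 1 "1 / (s - t)" "- 1 / (s - t)" 1 "-1" 1]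
        ser_lincomb[OF sm(1,2) f, of "1 / (s - t)" "- 1 / (s - t)"]
        ser_lincomb[OF sm(3,2) f, of "- 1" 1]
        ser_shift[OF sm(2) f] B_ser[OF sm(2) f]
      unfolding ae_eq_def q heat_def
      by eventually_elim (simp add: diff_divide_distrib)
    ultimately show ?case by (rule Lp_cball_ae_eq[OF p])
  qed
qed

text \<open>The time shift t serves \<open>heat_add\<close>; t = 0 gives the orbit itself.\<close>

lemma heat_has_derivative_on:
  assumes f: "f \<in> Lp p" and t: "0 \<le> t"
  shows "Lp_has_derivative_on p {0..T} (\<lambda>s. heat (s + t) f) (\<lambda>s x. B (heat (s + t) f) x - heat (s + t) f x)"
  unfolding Lp_has_derivative_on_def
proof (intro ballI conjI)
  fix s assume s: "s \<in> {0..T}"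
  then have st: "0 \<le> s + t" using t by simp
  show "heat (s + t) f \<in> Lp p" using st f by (rule heat_Lp)
  then show "(\<lambda>x. B (heat (s + t) f) x - heat (s + t) f x) \<in> Lp p" by (rule generator_Lp)
  have "filterlim (\<lambda>r. r + t) (at (s + t) within {0..}) (at s within {0..T})"
    unfolding filterlim_at using eventually_at_within_mem[where t = s and J = "{0..T}"]
    by (auto intro!: tendsto_intros elim!: eventually_mono simp: t)
  from filterlim_compose[OF heat_tendsto[OF st f, unfolded Lp_tendsto_def] this]
  show "Lp_tendsto p (\<lambda>r x. (heat (r + t) f x - heat (s + t) f x) / (r - s))
      (\<lambda>x. B (heat (s + t) f) x - heat (s + t) f x) (at s within {0..T})"
    by (simp add: Lp_tendsto_def)
qed

text \<open>Uniqueness in \<open>L\<^sup>1\<close>: let \<open>e\<^sup>-\<^sup>4\<^sup>t \<parallel>w t\<parallel>\<close> attain its maximum \<open>G\<close> at \<open>t\<^sub>0\<close>. Pairing with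
  \<open>sgn (w t\<^sub>0)\<close> and integrating \<open>\<parallel>w'\<parallel> \<le> 2 \<parallel>w\<parallel> \<le> 2 G e\<^sup>4\<^sup>t\<close> gives
  \<open>G e\<^bsup>4t\<^sub>0\<^esup> = \<parallel>w t\<^sub>0\<parallel> \<le> G (e\<^bsup>4t\<^sub>0\<^esup> - 1) / 2\<close>, so \<open>G = 0\<close>.\<close>

lemma zero_solution:
  assumes w: "Lp_has_derivative_on p {0..T} w w'"
    and eq: "\<And>t. t \<in> {0..T} \<Longrightarrow> ae_eq (w' t) (\<lambda>x. B (w t) x - w t x)"
    and w0: "ae_eq (w 0) (\<lambda>x. 0)" and t: "t \<in> {0..T}"
  shows "ae_eq (w t) (\<lambda>x. 0)"
proof -
  have mem: "w s \<in> Lp p" "w' s \<in> Lp p" if "s \<in> {0..T}" for s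
    using w that by (auto simp: Lp_has_derivative_on_def)
  note int = Lp_integrable[OF p]
  define N where "N s = (LINT x|unit_leb. \<bar>w s x\<bar>)" for s
  have N0: "N 0 = 0"
  proof -
    have "N 0 = (LINT x|unit_leb. 0)"
      unfolding N_def using w0 Lp_measurable[OF mem(1)[of 0]] t
      by (intro integral_cong_AE) (auto simp: ae_eq_def)
    then show ?thesis by simp
  qed
  have w'_le: "(LINT x|unit_leb. \<bar>w' s x\<bar>) \<le> 2 * N s" if s: "s \<in> {0..T}" for s
  proof -
    have Bw: "B (w s) \<in> Lp p" using mem(1)[OF s] by (rule Lp_bounded_linearD(1)[OF B_linear])
    have "(LINT x|unit_leb. \<bar>w' s x\<bar>) \<le> (LINT x|unit_leb. \<bar>B (w s) x\<bar> + \<bar>w s x\<bar>)"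
      using int[OF mem(1)[OF s]] int[OF mem(2)[OF s]] int[OF Bw] eq[OF s]
      by (intro integral_mono_AE) (auto simp: ae_eq_def elim!: eventually_mono)
    also have "\<dots> \<le> N s + N s"
      using int[OF mem(1)[OF s]] int[OF Bw] B_L1[OF mem(1)[OF s]] by (simp add: N_def)
    finally show ?thesis by simp
  qed
  \<comment> \<open>The rate 4 is twice the constant in \<open>w'_le\<close>; this produces the
    factor 1 / 2 on which the estimate at \<open>t0\<close> depends.\<close>
  have "continuous_on {0..T} (\<lambda>s. exp (- 4 * s) * N s)"
    unfolding N_def by (intro continuous_intros Lp_has_derivative_on_L1_continuous[OF p w])
  then obtain t0 where t0: "t0 \<in> {0..T}"
    and max: "\<And>s. s \<in> {0..T} \<Longrightarrow> exp (- 4 * s) * N s \<le> exp (- 4 * t0) * N t0"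
    using continuous_attains_sup[of "{0..T}" "\<lambda>s. exp (- 4 * s) * N s"] t by fastforce
  define G where "G = exp (- 4 * t0) * N t0"
  have N_le: "N s \<le> G * exp (4 * s)" if "s \<in> {0..T}" for s
  proof -
    have "N s = exp (4 * s) * (exp (- 4 * s) * N s)" by (simp add: mult.assoc[symmetric] exp_add[symmetric])
    also have "\<dots> \<le> exp (4 * s) * G" unfolding G_def by (intro mult_left_mono max that) simp
    finally show ?thesis by (simp add: mult.commute)
  qed
  have N_t0: "N t0 = G * exp (4 * t0)"
    by (simp add: G_def exp_minus field_simps)
  have "G \<le> 0"
  proof (cases "t0 = 0")
    case True
    then show ?thesis using N0 by (simp add: G_def)
  next
    case False
    with t0 have t0_pos: "0 < t0" by simp
    define g where "g x = sgn (w t0 x)" for x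
    have g [measurable]: "g \<in> borel_measurable unit_leb"
      using Lp_measurable[OF mem(1)[OF t0]] unfolding g_def by measurable
    have g1: "\<bar>g x\<bar> \<le> 1" for x by (simp add: g_def sgn_if)
    define \<phi> where "\<phi> s = (LINT x|unit_leb. w s x * g x)" for s
    \<comment> \<open>\<open>\<psi>\<close> is nondecreasing: G / 2 * exp (4 * s) has derivative 2 *
      G * exp (4 * s), which dominates 2 * N s and hence the derivative of the pairing.\<close>
    define \<psi> where "\<psi> s = G / 2 * exp (4 * s) - \<phi> s" for s
    define \<psi>' where "\<psi>' s = 2 * G * exp (4 * s) - (LINT x|unit_leb. w' s x * g x)" for s
    have deriv: "(\<psi> has_real_derivative \<psi>' s) (at s within {0..t0})" if s: "s \<in> {0..t0}" for s
    proof -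
      have "(\<phi> has_real_derivative (LINT x|unit_leb. w' s x * g x)) (at s within {0..T})"
        unfolding \<phi>_def using s t0 by (intro Lp_has_derivative_on_pairing[OF p w _ g g1]) auto
      then have "(\<phi> has_real_derivative (LINT x|unit_leb. w' s x * g x)) (at s within {0..t0})"
        by (rule has_field_derivative_subset) (use t0 in auto)
      then show ?thesis unfolding \<psi>_def \<psi>'_def by (auto intro!: derivative_eq_intros)
    qed
    have nonneg: "0 \<le> \<psi>' s" if s: "s \<in> {0..T}" for s
    proof -
      have "(LINT x|unit_leb. w' s x * g x) \<le> (LINT x|unit_leb. \<bar>w' s x\<bar>)"
      proof (rule integral_mono')
        show "integrable unit_leb (\<lambda>x. \<bar>w' s x\<bar>)" using int[OF mem(2)[OF s]] by simp
        show "w' s x * g x \<le> \<bar>w' s x\<bar>" for x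
          by (rule order_trans[OF abs_ge_self]) (simp add: abs_mult mult_left_le g1)
      qed simp
      with w'_le[OF s] N_le[OF s] show ?thesis by (simp add: \<psi>'_def)
    qed
    obtain z where z: "z \<in> {0<..<t0}" "\<psi> t0 - \<psi> 0 = \<psi>' z * (t0 - 0)"
    proof -
      have "\<exists>x\<in>{0<..<t0}. \<psi> t0 - \<psi> 0 = (\<lambda>h. \<psi>' x * h) (t0 - 0)"
        using deriv by (intro mvt_simple[OF t0_pos]) (auto simp: has_field_derivative_def)
      then show ?thesis using that by blast
    qed
    have "0 \<le> \<psi>' z * (t0 - 0)" using z t0 t0_pos by (intro mult_nonneg_nonneg nonneg) auto
    with z have "\<psi> 0 \<le> \<psi> t0" by simp
    moreover have "\<phi> t0 = N t0"
      unfolding \<phi>_def N_def g_def by (intro Bochner_Integration.integral_cong) (auto simp: sgn_if)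
    moreover have "\<phi> 0 = 0"
    proof -
      have "\<phi> 0 = (LINT x|unit_leb. 0)"
        unfolding \<phi>_def using w0 Lp_measurable[OF mem(1)[of 0]] t
        by (intro integral_cong_AE) (auto simp: ae_eq_def)
      then show ?thesis by simp
    qed
    ultimately have "G + G * exp (4 * t0) \<le> 0" by (simp add: \<psi>_def N_t0)
    moreover have "0 \<le> G" by (simp add: G_def N_def)
    then have "0 \<le> G * exp (4 * t0)" by simp
    ultimately show ?thesis by linarith
  qed
  then have "G * exp (4 * t) \<le> 0" by (simp add: mult_nonpos_nonneg)
  with N_le[OF t] have "N t \<le> 0" by linarith
  then show ?thesis unfolding N_def by (intro ae_eqI_L1 int mem t)
qed

lemma solution_unique:
  assumes u: "Lp_has_derivative_on p {0..T} u u'" "\<And>t. t \<in> {0..T} \<Longrightarrow> ae_eq (u' t) (\<lambda>x. B (u t) x - u t x)"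
    and v: "Lp_has_derivative_on p {0..T} v v'" "\<And>t. t \<in> {0..T} \<Longrightarrow> ae_eq (v' t) (\<lambda>x. B (v t) x - v t x)"
    and 0: "ae_eq (u 0) (v 0)" and t: "t \<in> {0..T}"
  shows "ae_eq (u t) (v t)"
proof -
  have "ae_eq (\<lambda>x. u t x - v t x) (\<lambda>x. 0)"
  proof (rule zero_solution[OF Lp_has_derivative_on_diff[OF p u(1) v(1)] _ _ t])
    fix s assume s: "s \<in> {0..T}"
    then have "u s \<in> Lp p" "v s \<in> Lp p" using u v by (auto simp: Lp_has_derivative_on_def)
    from Lp_bounded_linear_diff[OF p B_linear this] u(2)[OF s] v(2)[OF s]
    show "ae_eq (\<lambda>x. u' s x - v' s x) (\<lambda>x. B (\<lambda>x. u s x - v s x) x - (u s x - v s x))"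
      unfolding ae_eq_def by eventually_elim simp
  next
    show "ae_eq (\<lambda>x. u 0 x - v 0 x) (\<lambda>x. 0)"
      using 0 unfolding ae_eq_def by (rule eventually_mono) simp
  qed
  then show ?thesis by (simp add: ae_eq_def)
qed

text \<open>As curves in s both sides solve the same equation and agree at s = 0, so uniqueness
  replaces a Cauchy product.\<close>

lemma heat_add:
  assumes s: "0 \<le> s" and t: "0 \<le> t" and f: "f \<in> Lp p"
  shows "ae_eq (heat (s + t) f) (heat s (heat t f))"
proof (rule solution_unique[where u = "\<lambda>s. heat (s + t) f" and v = "\<lambda>s. heat s (heat t f)" and T = s])
  show "Lp_has_derivative_on p {0..s} (\<lambda>s. heat (s + t) f) (\<lambda>s x. B (heat (s + t) f) x - heat (s + t) f x)"
    using f t by (rule heat_has_derivative_on)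
  show "Lp_has_derivative_on p {0..s} (\<lambda>s. heat s (heat t f)) (\<lambda>s x. B (heat s (heat t f)) x - heat s (heat t f) x)"
    using heat_has_derivative_on[OF heat_Lp[OF t f], of 0] by simp
qed (use s in \<open>auto simp: heat_0 ae_eq_refl\<close>)

lemma heat_minus_id_cball:
  assumes t: "0 \<le> t" and f: "f \<in> Lp_cball p 1"
  shows "(\<lambda>x. heat t f x - f x) \<in> Lp_cball p (2 * (1 - exp (- t)))"
proof -
  let ?a = "\<lambda>n. 1 * poisson t n + (- 1) * poisson 0 n"
  \<comment> \<open>At n = 0 the value is 1 - exp (- t), and the other weights have the same sum;
    the coefficient 1 - 2 * exp (- t) fits both cases into one formula.\<close>
  have "\<bar>?a n\<bar> = poisson t n + (1 - 2 * exp (- t)) * poisson 0 n" for n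
    using t poisson_nonneg[OF t, of n] by (cases n) (auto simp: poisson_0 poisson_def)
  then have sums: "(\<lambda>n. \<bar>?a n\<bar>) sums (1 + (1 - 2 * exp (- t)) * 1)"
    by (simp only:) (intro sums_add sums_mult poisson_sums)
  have "ser ?a f \<in> Lp_cball p (2 * (1 - exp (- t)))"
    using ser_cball[OF sums_summable[OF sums] f] sums_unique[OF sums] by simp
  moreover have "ae_eq (ser ?a f) (\<lambda>x. heat t f x - f x)"
    using ser_lincomb[OF summable_abs_poisson[OF t] summable_abs_poisson[OF order_refl] Lp_cballD(1)[OF f], of 1 "-1"]
      heat_0[of f] by (simp add: heat_def)
  ultimately show ?thesis by (rule Lp_cball_ae_eq[OF p])
qed

lemma heat_semigroup: "uniformly_continuous_semigroup p heat"
  unfolding uniformly_continuous_semigroup_def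
proof (intro conjI allI ballI impI)
  fix t :: real assume "0 \<le> t"
  then show "Lp_bounded_linear p (heat t)" by (rule heat_linear)
next
  fix f show "ae_eq (heat 0 f) f" by (simp add: heat_0 ae_eq_refl)
next
  fix s t :: real and f assume "0 \<le> s" "0 \<le> t" "f \<in> Lp p"
  then show "ae_eq (heat (s + t) f) (heat s (heat t f))" by (rule heat_add)
next
  have "((\<lambda>t. 2 * (1 - exp (- t))) \<longlongrightarrow> 2 * (1 - exp (- 0))) (at_right (0::real))"
    by (intro tendsto_intros)
  then have lim: "((\<lambda>t. 2 * (1 - exp (- t))) \<longlongrightarrow> 0) (at_right (0::real))" by simp
  \<comment> \<open>The supremum in \<open>Lp_opnorm\<close> is over reals and needs a nonempty
    family; the zero function supplies a member.\<close>
  have zero: "(\<lambda>x. 0) \<in> Lp_cball p 1"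
    by (rule Lp_cball_mono[OF Lp_cball_zero[OF p]]) simp
  have bound: "Lp_norm p (\<lambda>x. heat t f x - f x) \<le> 2 * (1 - exp (- t))" if "0 \<le> t" "f \<in> Lp_cball p 1" for t f
    using heat_minus_id_cball[OF that] by (rule Lp_cballD)
  have ball: "{f \<in> Lp p. Lp_norm p f \<le> 1} = Lp_cball p 1" by (simp add: Lp_cball_def)
  show "((\<lambda>t. Lp_opnorm p (\<lambda>f x. heat t f x - f x)) \<longlongrightarrow> 0) (at_right 0)"
  proof (rule tendsto_sandwich[OF _ _ tendsto_const lim])
    have pos: "\<forall>\<^sub>F t in at_right 0. 0 \<le> (t::real)"
      using eventually_at_right_less by (rule eventually_mono) simp
    show "\<forall>\<^sub>F t in at_right 0. Lp_opnorm p (\<lambda>f x. heat t f x - f x) \<le> 2 * (1 - exp (- t))"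
      using pos
    proof eventually_elim
      case (elim t)
      then show ?case unfolding Lp_opnorm_def ball using zero bound by (intro cSUP_least) auto
    qed
    show "\<forall>\<^sub>F t in at_right 0. 0 \<le> Lp_opnorm p (\<lambda>f x. heat t f x - f x)"
      using pos
    proof eventually_elim
      case (elim t)
      then show ?case unfolding Lp_opnorm_def ball
        by (intro cSUP_upper2[OF _ zero] Lp_norm_nonneg bdd_aboveI2[OF bound])
    qed
  qed
qed

lemma heat_generated_by:
  assumes A: "\<And>f. f \<in> Lp p \<Longrightarrow> ae_eq (\<lambda>x. B f x - f x) (A f)"
  shows "generated_by p heat A"
  unfolding generated_by_def
proof (intro ballI conjI)
  fix f assume f: "f \<in> Lp p"
  show "A f \<in> Lp p" by (rule Lp_ae_eq[OF p generator_Lp[OF f] A[OF f]])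
  have "Lp_tendsto p (\<lambda>t x. (heat t f x - f x) / t) (\<lambda>x. B f x - f x) (at_right 0)"
    using heat_tendsto[OF order_refl f] unfolding Lp_tendsto_def heat_0 diff_0_right
    by (rule tendsto_within_subset) auto
  moreover have "\<forall>\<^sub>F t in at_right 0. (\<lambda>x. (heat t f x - f x) / t) \<in> Lp p"
    using eventually_at_right_less by (rule eventually_mono) (auto intro!: Lp_quotient[OF p] heat_Lp f)
  ultimately show "Lp_tendsto p (\<lambda>t x. (heat t f x - f x) / t) (A f) (at_right 0)"
    by (rule Lp_tendsto_ae_cong[OF p _ _ generator_Lp[OF f] A[OF f]])
qed

end

section \<open>Operator norms\<close>

lemma Lp_cball_opnorm:
  assumes p: "1 \<le> p" and A: "Lp_bounded_linear p A" and f: "f \<in> Lp p"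
  shows "A f \<in> Lp_cball p (Lp_opnorm p A * Lp_norm p f)"
proof (cases "Lp_norm p f = 0")
  case True
  obtain C where C: "\<And>f D. f \<in> Lp_cball p D \<Longrightarrow> A f \<in> Lp_cball p (C * D)"
    using Lp_bounded_linear_bound[OF A] by metis
  from C[OF Lp_cball_norm[OF f]] True show ?thesis by simp
next
  case False
  obtain C where C: "\<And>f D. f \<in> Lp_cball p D \<Longrightarrow> A f \<in> Lp_cball p (C * D)"
    using Lp_bounded_linear_bound[OF A] by metis
  define N where "N = Lp_norm p f"
  have N: "0 < N" using False Lp_norm_nonneg[of p f] by (simp add: N_def)
  define g where "g x = (1 / N) * f x" for x
  have g: "g \<in> Lp_cball p 1"
    using Lp_cball_scale[OF p Lp_cball_norm[OF f], of "1 / N"] N by (simp add: g_def[abs_def] N_def)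
  have f_eq: "f = (\<lambda>x. N * g x)" using N by (auto simp: g_def)
  have ball: "{f \<in> Lp p. Lp_norm p f \<le> 1} = Lp_cball p 1" by (simp add: Lp_cball_def)
  \<comment> \<open>A supremum of reals bounds its members only for a family bounded above, which
    the constant \<open>C\<close> provides.\<close>
  have "Lp_norm p (A g) \<le> Lp_opnorm p A"
    unfolding Lp_opnorm_def ball
  proof (rule cSUP_upper[OF g], rule bdd_aboveI2)
    fix h assume "h \<in> Lp_cball p 1"
    from C[OF this] show "Lp_norm p (A h) \<le> C * 1" by (rule Lp_cballD)
  qed
  then have "A g \<in> Lp_cball p (Lp_opnorm p A)"
    using Lp_bounded_linearD(1)[OF A Lp_cballD(1)[OF g]] by (simp add: Lp_cball_def)
  from Lp_cball_scale[OF p this, of N] have "(\<lambda>x. N * A g x) \<in> Lp_cball p (Lp_opnorm p A * N)"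
    using N by (simp add: mult.commute)
  moreover have "ae_eq (\<lambda>x. N * A g x) (A f)"
    using Lp_bounded_linearD(3)[OF A Lp_cballD(1)[OF g], of N] unfolding f_eq by (rule ae_eq_sym)
  ultimately show ?thesis unfolding N_def by (rule Lp_cball_ae_eq[OF p])
qed

lemma Lp_bounded_linear_minus_id:
  assumes p: "1 \<le> p" and A: "Lp_bounded_linear p A"
  shows "Lp_bounded_linear p (\<lambda>f x. A f x - f x)"
proof -
  obtain C where C: "\<And>f D. f \<in> Lp_cball p D \<Longrightarrow> A f \<in> Lp_cball p (C * D)"
    using Lp_bounded_linear_bound[OF A] by metis
  show ?thesis
  proof (rule Lp_bounded_linearI[of p _ "C + 1"])
    fix f D assume "f \<in> Lp_cball p D"
    then show "(\<lambda>x. A f x - f x) \<in> Lp_cball p ((C + 1) * D)"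
      using Lp_cball_diff[OF p C] by (simp add: distrib_right)
  next
    fix f g assume "f \<in> Lp p" "g \<in> Lp p"
    from Lp_bounded_linearD(2)[OF A this]
    show "ae_eq (\<lambda>x. A (\<lambda>x. f x + g x) x - (f x + g x)) (\<lambda>x. A f x - f x + (A g x - g x))"
      unfolding ae_eq_def by (rule eventually_mono) simp
  next
    fix f c assume "f \<in> Lp p"
    from Lp_bounded_linearD(3)[OF A this]
    show "ae_eq (\<lambda>x. A (\<lambda>x. c * f x) x - c * f x) (\<lambda>x. c * (A f x - f x))"
      unfolding ae_eq_def by (rule eventually_mono) (simp add: right_diff_distrib)
  qed
qed

subsection \<open>Orbits of uniformly continuous semigroups\<close>

locale Lp_semigroup =
  fixes p :: ereal and S :: "real \<Rightarrow> (real \<Rightarrow> real) \<Rightarrow> real \<Rightarrow> real"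
  assumes p: "1 \<le> p" and S: "uniformly_continuous_semigroup p S"
begin

lemma linear: "0 \<le> t \<Longrightarrow> Lp_bounded_linear p (S t)"
  and zero: "f \<in> Lp p \<Longrightarrow> ae_eq (S 0 f) f"
  and add: "0 \<le> s \<Longrightarrow> 0 \<le> t \<Longrightarrow> f \<in> Lp p \<Longrightarrow> ae_eq (S (s + t) f) (S s (S t f))"
  and uniform: "((\<lambda>t. Lp_opnorm p (\<lambda>f x. S t f x - f x)) \<longlongrightarrow> 0) (at_right 0)"
  using S by (auto simp: uniformly_continuous_semigroup_def)

lemma mem: "0 \<le> t \<Longrightarrow> f \<in> Lp p \<Longrightarrow> S t f \<in> Lp p"
  by (rule Lp_bounded_linearD(1)[OF linear])

lemma minus_id_cball:
  "0 \<le> t \<Longrightarrow> f \<in> Lp p \<Longrightarrow> (\<lambda>x. S t f x - f x) \<in> Lp_cball p (Lp_opnorm p (\<lambda>f x. S t f x - f x) * Lp_norm p f)"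
  by (rule Lp_cball_opnorm[OF p Lp_bounded_linear_minus_id[OF p linear]])

text \<open>Near time 0 the operators differ from the identity by less than 1 in norm, so they have
  norm at most 2; the semigroup law doubles the bound with each step of length h.\<close>

lemma locally_bounded:
  obtains M where "\<And>t f C. 0 \<le> t \<Longrightarrow> t \<le> T \<Longrightarrow> f \<in> Lp_cball p C \<Longrightarrow> S t f \<in> Lp_cball p (M * C)"
proof -
  have "\<forall>\<^sub>F t in at_right 0. Lp_opnorm p (\<lambda>f x. S t f x - f x) < 1"
    using uniform by (rule order_tendstoD) simp
  then obtain d where d: "0 < d" and small: "\<And>t. 0 < t \<Longrightarrow> t < d \<Longrightarrow> Lp_opnorm p (\<lambda>f x. S t f x - f x) < 1"
    unfolding eventually_at_right_field by auto
  \<comment> \<open>Half of d keeps the closed interval up to h inside the range where the estimate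
    is known.\<close>
  define h where "h = d / 2"
  have h: "0 < h" using d by (simp add: h_def)
  have step: "S r f \<in> Lp_cball p (2 * C)" if r: "0 \<le> r" "r \<le> h" and f: "f \<in> Lp_cball p C" for r f C
  proof (cases "r = 0")
    case True
    have "S 0 f \<in> Lp_cball p C"
      using f ae_eq_sym[OF zero[OF Lp_cballD(1)[OF f]]] by (rule Lp_cball_ae_eq[OF p])
    then show ?thesis using True Lp_cballD(3)[OF f] by (auto elim: Lp_cball_mono)
  next
    case False
    then have "Lp_opnorm p (\<lambda>f x. S r f x - f x) * Lp_norm p f \<le> 1 * C"
      using small[of r] r d Lp_cballD[OF f] Lp_norm_nonneg[of p f]
      by (intro mult_mono) (auto simp: h_def)
    with minus_id_cball[of r f] r Lp_cballD(1)[OF f]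
    have "(\<lambda>x. S r f x - f x) \<in> Lp_cball p C" by (auto intro: Lp_cball_mono)
    from Lp_cball_add[OF p this f] show ?thesis by simp
  qed
  have pow: "S t f \<in> Lp_cball p (2 ^ Suc n * C)"
    if "0 \<le> t" "t \<le> real (Suc n) * h" "f \<in> Lp_cball p C" for n t f C
    using that
  proof (induction n arbitrary: t f C)
    case 0
    then show ?case using step by simp
  next
    case (Suc n)
    show ?case
    proof (cases "t \<le> h")
      case True
      have "2 ^ 1 \<le> (2 ^ Suc (Suc n) :: real)" by (intro power_increasing) auto
      then have "2 * C \<le> 2 ^ Suc (Suc n) * C"
        using Lp_cballD(3)[OF Suc.prems(3)] by (intro mult_right_mono) auto
      with step[OF Suc.prems(1) True Suc.prems(3)] show ?thesis by (rule Lp_cball_mono)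
    next
      case False
      then have th: "0 \<le> t - h" by simp
      have "S (t - h) (S h f) \<in> Lp_cball p (2 ^ Suc n * (2 * C))"
        using Suc.prems th h by (intro Suc.IH step) (auto simp: distrib_right)
      moreover have "ae_eq (S (t - h) (S h f)) (S t f)"
        using add[OF th less_imp_le[OF h] Lp_cballD(1)[OF Suc.prems(3)]] by (simp add: ae_eq_sym)
      ultimately have "S t f \<in> Lp_cball p (2 ^ Suc n * (2 * C))" by (rule Lp_cball_ae_eq[OF p])
      then show ?thesis by (simp add: mult_ac)
    qed
  qed
  obtain n where n: "T \<le> real n * h" using ex_less_of_nat_mult[OF h, of T] by (auto intro: less_imp_le)
  show ?thesis
  proof (rule that)
    fix t f C assume "0 \<le> t" "t \<le> T" "f \<in> Lp_cball p C"
    then show "S t f \<in> Lp_cball p (2 ^ Suc n * C)"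
      using n h by (intro pow) (auto simp: distrib_right)
  qed
qed

text \<open>With no negative times available, every increment is written as a forward step from the
  earlier time; bounds on \<open>S a\<close> then also control left limits.\<close>

lemma increment:
  assumes a: "0 \<le> a" and h: "0 \<le> h" and f: "f \<in> Lp p"
  shows "ae_eq (S a (\<lambda>x. S h f x - f x)) (\<lambda>x. S (a + h) f x - S a f x)"
  using Lp_bounded_linear_diff[OF p linear[OF a] mem[OF h f] f] add[OF a h f]
  unfolding ae_eq_def by eventually_elim simp

lemma filterlim_distance: "filterlim (\<lambda>s. \<bar>s - t\<bar>) (at_right 0) (at (t::real) within J)"
proof -
  have "((\<lambda>s. \<bar>s - t\<bar>) \<longlongrightarrow> \<bar>t - t\<bar>) (at t within J)" by (intro tendsto_intros)
  then show ?thesis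
    unfolding filterlim_at using eventually_at_within_mem[where t = t and J = J]
    by (auto elim!: eventually_mono)
qed

lemma orbit_tendsto:
  assumes f: "f \<in> Lp p" and t: "t \<in> {0..T}"
  shows "Lp_tendsto p (\<lambda>s. S s f) (S t f) (at t within {0..T})"
proof -
  obtain M where M: "\<And>t f C. 0 \<le> t \<Longrightarrow> t \<le> T \<Longrightarrow> f \<in> Lp_cball p C \<Longrightarrow> S t f \<in> Lp_cball p (M * C)"
    using locally_bounded by metis
  let ?w = "\<lambda>h. Lp_opnorm p (\<lambda>f x. S h f x - f x)"
  show ?thesis
  proof (rule Lp_tendstoI)
    show "((\<lambda>s. M * (?w \<bar>s - t\<bar> * Lp_norm p f)) \<longlongrightarrow> 0) (at t within {0..T})"
      by (intro tendsto_mult_right_zero tendsto_mult_left_zero filterlim_compose[OF uniform filterlim_distance])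
    show "\<forall>\<^sub>F s in at t within {0..T}. (\<lambda>x. S s f x - S t f x) \<in> Lp_cball p (M * (?w \<bar>s - t\<bar> * Lp_norm p f))"
      using eventually_at_within_mem
    proof eventually_elim
      case (elim s)
      \<comment> \<open>The step of length h runs forward from the earlier of the two times; sgn (s
        - t) restores the direction.\<close>
      define a where "a = min s t"
      define h where "h = \<bar>s - t\<bar>"
      have a: "0 \<le> a" "a \<le> T" and h: "0 \<le> h" using elim t by (auto simp: a_def h_def)
      have "S a (\<lambda>x. S h f x - f x) \<in> Lp_cball p (M * (?w h * Lp_norm p f))"
        by (intro M a minus_id_cball h f)
      then have "(\<lambda>x. S (a + h) f x - S a f x) \<in> Lp_cball p (M * (?w h * Lp_norm p f))"
        using increment[OF a(1) h f] by (rule Lp_cball_ae_eq[OF p])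
      then have "(\<lambda>x. sgn (s - t) * (S (a + h) f x - S a f x)) \<in> Lp_cball p (M * (?w h * Lp_norm p f))"
        using Lp_cball_scale[OF p, of _ _ "sgn (s - t)"] elim by (simp add: abs_sgn_eq)
      moreover have "(\<lambda>x. sgn (s - t) * (S (a + h) f x - S a f x)) = (\<lambda>x. S s f x - S t f x)"
        using elim by (auto simp: a_def h_def min_def sgn_if)
      ultimately show ?case by (simp add: h_def)
    qed
  qed
qed

context
  fixes A assumes A: "generated_by p S A"
begin

lemma generator_mem: "f \<in> Lp p \<Longrightarrow> A f \<in> Lp p"
  and generator_tendsto: "f \<in> Lp p \<Longrightarrow> ((\<lambda>h. Lp_norm p (\<lambda>x. (S h f x - f x) / h - A f x)) \<longlongrightarrow> 0) (at_right 0)"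
  using A by (auto simp: generated_by_def Lp_tendsto_def)

lemma quotient_cball:
  assumes h: "0 < h" and f: "f \<in> Lp p"
  shows "(\<lambda>x. (S h f x - f x) / h - A f x) \<in> Lp_cball p (Lp_norm p (\<lambda>x. (S h f x - f x) / h - A f x))"
  using h by (intro Lp_cball_norm Lp_diff[OF p] Lp_quotient[OF p] mem f generator_mem) auto

lemma increment_quotient:
  assumes a: "0 \<le> a" and h: "0 < h" and f: "f \<in> Lp p"
  shows "ae_eq (S a (\<lambda>x. (S h f x - f x) / h - A f x)) (\<lambda>x. (S (a + h) f x - S a f x) / h - S a (A f) x)"
proof -
  have D: "(\<lambda>x. S h f x - f x) \<in> Lp p" using h f by (intro Lp_diff[OF p] mem) auto
  have "ae_eq (S a (\<lambda>x. (1 / h) * (S h f x - f x))) (\<lambda>x. (1 / h) * S a (\<lambda>x. S h f x - f x) x)"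
    by (rule Lp_bounded_linearD(3)[OF linear[OF a] D])
  then show ?thesis
    using Lp_bounded_linear_diff[OF p linear[OF a] Lp_scale[OF p D, of "1 / h"] generator_mem[OF f]]
      increment[OF a less_imp_le[OF h] f]
    unfolding ae_eq_def by eventually_elim simp
qed

text \<open>\<open>generated_by\<close> gives neither linearity nor continuity of \<open>A\<close>.
  Both sides are therefore obtained as limits of one quotient: S t applied to (S h f - f) / h equals
  (S h (S t f) - S t f) / h almost everywhere.\<close>

lemma generator_commute:
  assumes t: "0 \<le> t" and f: "f \<in> Lp p"
  shows "ae_eq (S t (A f)) (A (S t f))"
proof -
  obtain M where M: "\<And>s f C. 0 \<le> s \<Longrightarrow> s \<le> t \<Longrightarrow> f \<in> Lp_cball p C \<Longrightarrow> S s f \<in> Lp_cball p (M * C)"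
    using locally_bounded by metis
  let ?e = "\<lambda>f h. Lp_norm p (\<lambda>x. (S h f x - f x) / h - A f x)"
  have Stf: "S t f \<in> Lp p" using t f by (rule mem)
  have "(\<lambda>x. S t (A f) x - A (S t f) x) \<in> Lp_cball p (?e (S t f) h + M * ?e f h)" if h: "0 < h" for h
  proof -
    have 1: "S t (\<lambda>x. (S h f x - f x) / h - A f x) \<in> Lp_cball p (M * ?e f h)"
      by (intro M t order_refl quotient_cball h f)
    have eq: "ae_eq (S (t + h) f) (S h (S t f))"
      using add[of h t f] h t f by (simp add: add.commute)
    show ?thesis
    proof (rule Lp_cball_ae_eq[OF p Lp_cball_diff[OF p quotient_cball[OF h Stf] 1]])
      show "ae_eq (\<lambda>x. (S h (S t f) x - S t f x) / h - A (S t f) x - S t (\<lambda>x. (S h f x - f x) / h - A f x) x)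
          (\<lambda>x. S t (A f) x - A (S t f) x)"
        using increment_quotient[OF t h f] eq unfolding ae_eq_def by eventually_elim simp
    qed
  qed
  then have le: "Lp_norm p (\<lambda>x. S t (A f) x - A (S t f) x) \<le> ?e (S t f) h + M * ?e f h" if "0 < h" for h
    using that by (blast dest: Lp_cballD(2))
  have "Lp_norm p (\<lambda>x. S t (A f) x - A (S t f) x) \<le> 0"
  proof (rule tendsto_lowerbound)
    show "((\<lambda>h. ?e (S t f) h + M * ?e f h) \<longlongrightarrow> 0) (at_right 0)"
      by (intro tendsto_add_zero tendsto_mult_right_zero generator_tendsto f Stf)
    show "\<forall>\<^sub>F h in at_right 0. Lp_norm p (\<lambda>x. S t (A f) x - A (S t f) x) \<le> ?e (S t f) h + M * ?e f h"
      using eventually_at_right_less by (rule eventually_mono) (rule le)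
  qed simp
  moreover have "(\<lambda>x. S t (A f) x - A (S t f) x) \<in> Lp p"
    by (intro Lp_diff[OF p] mem generator_mem t f)
  ultimately show ?thesis
    by (subst Lp_cball_0_iff[OF p, symmetric]) (simp add: Lp_cball_def)
qed

text \<open>Two-sided derivatives: for \<open>a = min s t\<close> and \<open>h = \<bar>s - t\<bar>\<close> the difference quotient of
  the orbit equals \<open>S a ((S h f - f) / h)\<close>.\<close>

lemma orbit_C1:
  assumes f: "f \<in> Lp p"
  shows "Lp_C1_on p {0..T} (\<lambda>t. S t f) (\<lambda>t. S t (A f))"
  unfolding Lp_C1_on_def Lp_continuous_on_def Lp_has_derivative_on_def
proof (intro conjI ballI)
  fix t assume t: "t \<in> {0..T}"
  show "S t f \<in> Lp p" "S t (A f) \<in> Lp p" "S t (A f) \<in> Lp p"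
    using t f by (auto intro!: mem generator_mem)
  show cont: "Lp_tendsto p (\<lambda>s. S s (A f)) (S t (A f)) (at t within {0..T})"
    by (rule orbit_tendsto[OF generator_mem[OF f] t])
  obtain M where M: "\<And>s f C. 0 \<le> s \<Longrightarrow> s \<le> T \<Longrightarrow> f \<in> Lp_cball p C \<Longrightarrow> S s f \<in> Lp_cball p (M * C)"
    using locally_bounded by metis
  let ?e = "\<lambda>h. Lp_norm p (\<lambda>x. (S h f x - f x) / h - A f x)"
  let ?d = "\<lambda>s. Lp_norm p (\<lambda>x. S s (A f) x - S t (A f) x)"
  show "Lp_tendsto p (\<lambda>s x. (S s f x - S t f x) / (s - t)) (S t (A f)) (at t within {0..T})"
  proof (rule Lp_tendstoI)
    show "((\<lambda>s. M * ?e \<bar>s - t\<bar> + ?d s) \<longlongrightarrow> 0) (at t within {0..T})"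
      using cont unfolding Lp_tendsto_def
      by (intro tendsto_add_zero tendsto_mult_right_zero filterlim_compose[OF generator_tendsto[OF f] filterlim_distance])
    show "\<forall>\<^sub>F s in at t within {0..T}. (\<lambda>x. (S s f x - S t f x) / (s - t) - S t (A f) x) \<in> Lp_cball p (M * ?e \<bar>s - t\<bar> + ?d s)"
      using eventually_at_within_mem
    proof eventually_elim
      case (elim s)
      define a where "a = min s t"
      define h where "h = \<bar>s - t\<bar>"
      have a: "0 \<le> a" "a \<le> T" and h: "0 < h" using elim t by (auto simp: a_def h_def)
      have 1: "S a (\<lambda>x. (S h f x - f x) / h - A f x) \<in> Lp_cball p (M * ?e h)"
        by (intro M a quotient_cball h f)
      \<comment> \<open>For s > t this difference is 0. For s < t the quotient is close to
        \<open>S s (A f)\<close>, and continuity of the orbit of \<open>A f\<close> leads on to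
        \<open>S t (A f)\<close>.\<close>
      have 2: "(\<lambda>x. S a (A f) x - S t (A f) x) \<in> Lp_cball p (?d s)"
      proof (cases "s \<le> t")
        case True
        then show ?thesis unfolding a_def using elim t
          by (auto simp: min_def intro!: Lp_cball_norm Lp_diff[OF p] mem generator_mem f)
      next
        case False
        then show ?thesis unfolding a_def
          by (auto simp: min_def intro: Lp_cball_mono[OF Lp_cball_zero[OF p]] Lp_norm_nonneg)
      qed
      have "ae_eq (\<lambda>x. S a (\<lambda>x. (S h f x - f x) / h - A f x) x + (S a (A f) x - S t (A f) x))
          (\<lambda>x. (S (a + h) f x - S a f x) / h - S t (A f) x)"
        using increment_quotient[OF a(1) h f] unfolding ae_eq_def by (rule eventually_mono) simp
      with Lp_cball_add[OF p 1 2]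
      have "(\<lambda>x. (S (a + h) f x - S a f x) / h - S t (A f) x) \<in> Lp_cball p (M * ?e h + ?d s)"
        by (rule Lp_cball_ae_eq[OF p])
      moreover have "(S (a + h) f x - S a f x) / h = (S s f x - S t f x) / (s - t)" for x
      proof (cases "s \<le> t")
        case True
        then show ?thesis using minus_divide_divide[of "S s f x - S t f x" "s - t"] by (simp add: a_def h_def)
      qed (simp add: a_def h_def)
      ultimately show ?case by (simp add: h_def)
    qed
  qed
qed

end

end

subsection \<open>Graphons\<close>

lemma AE_unit_leb: "(AE x in lborel. P x) \<Longrightarrow> (AE x in unit_leb. P x)"
  by (subst AE_restrict_space_iff) (auto dest: AE_completion elim!: eventually_mono)

lemma AE_unit_leb_mem: "AE x in unit_leb. x \<in> {0<..<1}"
  using AE_space[of unit_leb] by simp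

text \<open>\<open>W\<close> is only Lebesgue measurable, so its sections need not all be measurable. Replacing it by a
  symmetric Borel function and cutting off where the degree exceeds 1 removes all exceptional sets.\<close>

lemma symmetric_kernel_representative:
  fixes W :: "real \<Rightarrow> real \<Rightarrow> real"
  assumes W_L1: "integrable (lebesgue_on ({0<..<1} \<times> {0<..<1})) (\<lambda>(x, y). W x y)"
    and W_sym: "\<And>x y. x \<in> {0<..<1} \<Longrightarrow> y \<in> {0<..<1} \<Longrightarrow> W x y = W y x"
    and W_nonneg: "\<And>x y. x \<in> {0<..<1} \<Longrightarrow> y \<in> {0<..<1} \<Longrightarrow> W x y \<ge> 0"
    and W_degree: "AE x in unit_leb. (LINT y|unit_leb. W x y) \<le> 1"
  obtains V where "symmetric_kernel V" "AE x in unit_leb. AE y in unit_leb. W x y = V x y"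
proof -
  define I where "I = {0<..<1::real}"
  define F where "F z = indicator (I \<times> I) z * (case z of (x, y) \<Rightarrow> W x y)" for z
  have "I \<times> I \<in> sets lebesgue"
    unfolding I_def by (intro sets_completionI_sets) (simp add: borel_open open_Times)
  then have "integrable lebesgue (\<lambda>z. indicator (I \<times> I) z *\<^sub>R (case z of (x, y) \<Rightarrow> W x y))"
    using W_L1 unfolding I_def[symmetric]
    by (subst (asm) integrable_restrict_space) auto
  then have F: "integrable lebesgue F" by (simp add: F_def[abs_def])
  then obtain g where g [measurable]: "g \<in> borel_measurable lborel" and Fg: "AE z in lborel. F z = g z"
    using completion_ex_borel_measurable_real[of F lborel] by auto
  have "(\<integral>\<^sup>+z. ennreal \<bar>g z\<bar> \<partial>lborel) = (\<integral>\<^sup>+z. ennreal \<bar>g z\<bar> \<partial>lebesgue)"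
    by (rule nn_integral_completion[symmetric])
  also have "\<dots> = (\<integral>\<^sup>+z. ennreal \<bar>F z\<bar> \<partial>lebesgue)"
    using AE_completion[OF Fg] by (intro nn_integral_cong_AE) (auto elim: eventually_mono)
  also have "\<dots> < \<infinity>" using F by (simp add: integrable_iff_bounded)
  finally have g_fin: "(\<integral>\<^sup>+z. ennreal \<bar>g z\<bar> \<partial>(lborel \<Otimes>\<^sub>M lborel)) < \<infinity>" by (simp add: lborel_prod)
  have g_pair [measurable]: "g \<in> borel_measurable (lborel \<Otimes>\<^sub>M lborel)" by (simp add: lborel_prod)
  have g_borel [measurable]: "g \<in> borel_measurable (borel \<Otimes>\<^sub>M borel)" by (simp add: borel_prod)
  have g_sec: "AE x in lborel. (\<integral>\<^sup>+y. ennreal \<bar>g (x, y)\<bar> \<partial>lborel) \<noteq> \<infinity>"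
    using g_fin by (intro nn_integral_PInf_AE) (auto simp: lborel.nn_integral_fst[symmetric])
  obtain N where N: "N \<in> null_sets (lborel \<Otimes>\<^sub>M lborel)" and FN: "\<And>z. z \<notin> N \<Longrightarrow> F z = g z"
    using Fg unfolding lborel_prod eventually_ae_filter by auto
  have N1: "AE x in lborel. AE y in lborel. (x, y) \<notin> N"
    using N by (intro lborel_pair.AE_pair AE_not_in)
  \<comment> \<open>\<open>AE_commute\<close> asks for a measurable set; the complement of
    \<open>N\<close> qualifies, and exchanging the quantifiers covers the reflected points (y,
    x).\<close>
  have "{z \<in> space (lborel \<Otimes>\<^sub>M lborel). (fst z, snd z) \<notin> N} = space (lborel \<Otimes>\<^sub>M lborel) - N"
    by auto
  then have "{z \<in> space (lborel \<Otimes>\<^sub>M lborel). (fst z, snd z) \<notin> N} \<in> sets (lborel \<Otimes>\<^sub>M lborel)"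
    using N by (simp only:) (intro sets.compl_sets null_setsD2)
  from lborel_pair.AE_commute[OF this] N1 have N2: "AE x in lborel. AE y in lborel. (y, x) \<notin> N"
    by (rule iffD1)
  \<comment> \<open>Averaging with the reflection and the maximum with 0 force symmetry and sign at
    every point; almost everywhere on the square they change nothing.\<close>
  define V0 where "V0 x y = max 0 ((g (x, y) + g (y, x)) / 2)" for x y
  have V0_nonneg: "0 \<le> V0 x y" for x y by (simp add: V0_def)
  have V0_borel: "(\<lambda>(x, y). V0 x y) \<in> borel_measurable (borel \<Otimes>\<^sub>M borel)"
    unfolding V0_def by measurable
  have V0_comp [measurable]: "(\<lambda>z. V0 (a z) (b z)) \<in> borel_measurable M"
    if [measurable]: "a \<in> borel_measurable M" "b \<in> borel_measurable M" for a b and M :: "'b measure"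
    unfolding V0_def by measurable
  have eq: "AE x in unit_leb. AE y in unit_leb. W x y = V0 x y \<and> \<bar>g (x, y)\<bar> = V0 x y"
    using AE_unit_leb[OF N1] AE_unit_leb[OF N2] AE_unit_leb_mem
  proof eventually_elim
    case (elim x)
    show ?case using AE_unit_leb[OF elim(1)] AE_unit_leb[OF elim(2)] AE_unit_leb_mem
    proof eventually_elim
      case (elim y)
      have x: "x \<in> {0<..<1}" by fact
      have "g (x, y) = W x y" "g (y, x) = W x y"
        using FN[of "(x, y)"] FN[of "(y, x)"] elim x W_sym[of x y] by (auto simp: F_def I_def indicator_def)
      with W_nonneg[OF x, of y] elim show ?case by (simp add: V0_def)
    qed
  qed
  define D where "D x = (\<integral>\<^sup>+y. ennreal (V0 x y) \<partial>unit_leb)" for x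
  have D [measurable]: "D \<in> borel_measurable borel"
    unfolding D_def by (rule unit_leb.borel_measurable_nn_integral) measurable
  \<comment> \<open>\<open>W_degree\<close> alone does not bound \<open>D x\<close>, since the
    Bochner integral of a non-integrable section is 0. \<open>g_sec\<close> supplies the missing
    finiteness for almost every x.\<close>
  have D1: "AE x in unit_leb. D x \<le> 1"
    using eq AE_unit_leb[OF g_sec] W_degree
  proof eventually_elim
    case (elim x)
    have gm: "(\<lambda>y. g (x, y)) \<in> borel_measurable lborel" by measurable
    have "D x = (\<integral>\<^sup>+y. ennreal \<bar>g (x, y)\<bar> \<partial>unit_leb)"
      unfolding D_def by (intro nn_integral_cong_AE eventually_mono[OF elim(1)]) auto
    also have "\<dots> \<le> (\<integral>\<^sup>+y. ennreal \<bar>g (x, y)\<bar> \<partial>lebesgue)"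
      by (subst nn_integral_restrict_space) (auto intro!: nn_integral_mono simp: indicator_def)
    also have "\<dots> = (\<integral>\<^sup>+y. ennreal \<bar>g (x, y)\<bar> \<partial>lborel)"
      by (rule nn_integral_completion)
    finally have fin: "D x < \<infinity>" using elim(2) by (auto simp: less_top)
    have int: "integrable unit_leb (V0 x)"
      using fin unfolding D_def by (intro integrableI_bounded) (auto simp: V0_nonneg)
    have V0W: "ae_eq (V0 x) (W x)"
      using elim(1) unfolding ae_eq_def by (rule eventually_mono) simp
    have "(LINT y|unit_leb. W x y) = (LINT y|unit_leb. V0 x y)"
      using V0W borel_measurable_ae_eq[OF _ V0W] unfolding ae_eq_def
      by (intro integral_cong_AE) (auto elim!: eventually_mono)
    moreover have "D x = ennreal (LINT y|unit_leb. V0 x y)"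
      unfolding D_def using int by (intro nn_integral_eq_integral) (auto simp: V0_nonneg)
    ultimately show ?case using elim(3) by simp
  qed
  \<comment> \<open>The cut-off acts in both variables to keep the symmetry; by \<open>D1\<close> it
    affects only null sets of x and of y in the interval.\<close>
  define V where "V x y = indicator {z. D z \<le> 1} x * indicator {z. D z \<le> 1} y * V0 x y" for x y
  have DS: "{z. D z \<le> 1} \<in> sets borel" by measurable
  show ?thesis
  proof (rule that)
    show "symmetric_kernel V"
    proof
      show "(\<lambda>(x, y). V x y) \<in> borel_measurable (borel \<Otimes>\<^sub>M borel)"
        unfolding V_def using DS by measurable
      fix x y
      show "0 \<le> V x y" by (simp add: V_def V0_nonneg)
      show "V x y = V y x" by (simp add: V_def V0_def add.commute)
      have "(\<integral>\<^sup>+y. ennreal (V x y) \<partial>unit_leb) \<le> 1" if "D x \<le> 1"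
      proof -
        have "(\<integral>\<^sup>+y. ennreal (V x y) \<partial>unit_leb) \<le> D x"
          unfolding D_def by (intro nn_integral_mono ennreal_leI) (auto simp: V_def V0_nonneg indicator_def)
        with that show ?thesis by (rule order_trans[rotated])
      qed
      moreover have "(\<integral>\<^sup>+y. ennreal (V x y) \<partial>unit_leb) \<le> 1" if "\<not> D x \<le> 1"
        using that by (simp add: V_def)
      ultimately show "(\<integral>\<^sup>+y. ennreal (V x y) \<partial>unit_leb) \<le> 1" by blast
    qed
    show "AE x in unit_leb. AE y in unit_leb. W x y = V x y"
      using eq D1
    proof eventually_elim
      case (elim x)
      from elim(1) D1 show ?case
        by eventually_elim (use elim(2) in \<open>simp add: V_def\<close>)
    qed
  qed
qed

lemma (in symmetric_kernel) graphon_diffusion_ae_eq: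
  assumes W: "AE x in unit_leb. AE y in unit_leb. W x y = V x y" and f: "integrable unit_leb f"
  shows "ae_eq (\<lambda>x. markov f x - f x) (graphon_diffusion W f)"
  using W markov_diffusion[OF f] unfolding ae_eq_def
proof eventually_elim
  case (elim x)
  have [measurable]: "f \<in> borel_measurable unit_leb" using f by auto
  have VW: "ae_eq (V x) (W x)"
    using elim(1) unfolding ae_eq_def by (rule eventually_mono) simp
  have [measurable]: "W x \<in> borel_measurable unit_leb"
    by (rule borel_measurable_ae_eq[OF _ VW]) measurable
  have "graphon_diffusion W f x = (LINT y|unit_leb. V x y * (f y - f x))"
    unfolding graphon_diffusion_def 
    by (intro integral_cong_AE eventually_mono[OF elim(1)]) auto
  with elim(2) show ?case by simp
qed

lemma (in symmetric_kernel) markov_contraction: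
  assumes p: "1 \<le> p"
  shows "Lp_contraction p markov"
proof
  show "1 \<le> p" by (rule p)
  show "Lp_bounded_linear p markov"
    using markov_cball[OF p] by (intro Lp_bounded_linearI[of p _ 1])
      (auto intro!: markov_add Lp_integrable[OF p] simp: markov_scale ae_eq_refl)
qed (auto intro: markov_cball[OF p] markov_L1_le Lp_integrable[OF p])

theorem theorem3p2:
  fixes W :: "real \<Rightarrow> real \<Rightarrow> real" and T :: real and p :: ereal and u\<^sub>0 :: "real \<Rightarrow> real"
  assumes W_L1: "integrable (lebesgue_on ({0<..<1} \<times> {0<..<1})) (\<lambda>(x, y). W x y)"
    and W_sym: "\<And>x y. x \<in> {0<..<1} \<Longrightarrow> y \<in> {0<..<1} \<Longrightarrow> W x y = W y x"
    and W_nonneg: "\<And>x y. x \<in> {0<..<1} \<Longrightarrow> y \<in> {0<..<1} \<Longrightarrow> W x y \<ge> 0"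
    and W_degree: "AE x in unit_leb. (LINT y|unit_leb. W x y) \<le> 1"
    and T: "T > 0"
    and p: "1 \<le> p"
    and u0: "u\<^sub>0 \<in> Lp p"
  shows "(uniformly_continuous_semigroup p (exp_semigroup p (graphon_diffusion W)) \<and>
          generated_by p (exp_semigroup p (graphon_diffusion W)) (graphon_diffusion W)) \<and>
         (\<exists>u. diffusion_solution p W T u\<^sub>0 u \<and>
           (\<forall>v. diffusion_solution p W T u\<^sub>0 v \<longrightarrow> (\<forall>t\<in>{0..T}. ae_eq (v t) (u t)))) \<and>
         (\<forall>u. diffusion_solution p W T u\<^sub>0 u \<longrightarrow>
           (\<forall>t\<in>{0..T}. ae_eq (u t) (exp_semigroup p (graphon_diffusion W) t u\<^sub>0))) \<and>
         (\<forall>T'>0. diffusion_solution p W T' u\<^sub>0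
           (\<lambda>t. exp_semigroup p (graphon_diffusion W) t u\<^sub>0)) \<and>
         (\<forall>t\<ge>0. Lp_norm p (exp_semigroup p (graphon_diffusion W) t u\<^sub>0) \<le> Lp_norm p u\<^sub>0)"
proof -
  let ?A = "graphon_diffusion W"
  define E where "E = exp_semigroup p ?A"
  obtain V where V: "symmetric_kernel V" and WV: "AE x in unit_leb. AE y in unit_leb. W x y = V x y"
    by (rule symmetric_kernel_representative[OF W_L1 W_sym W_nonneg W_degree])
  interpret symmetric_kernel V by (rule V)
  interpret Lp_contraction p markov by (rule markov_contraction[OF p])
  have A: "ae_eq (\<lambda>x. markov f x - f x) (?A f)" if "f \<in> Lp p" for f
    by (rule graphon_diffusion_ae_eq[OF WV Lp_integrable[OF p that]])
  \<comment> \<open>\<open>heat\<close> is the witness for the choice in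
    \<open>exp_semigroup\<close>.\<close>
  have "\<exists>S. uniformly_continuous_semigroup p S \<and> generated_by p S ?A"
    using heat_semigroup heat_generated_by[OF A] by blast
  then have E: "uniformly_continuous_semigroup p E" "generated_by p E ?A"
    unfolding E_def exp_semigroup_def by (metis (mono_tags, lifting) someI_ex)+
  interpret E: Lp_semigroup p E by unfold_locales (rule p, rule E)
  \<comment> \<open>\<open>orbit_C1\<close> has the generator inside the semigroup, the equation has
    it outside; \<open>generator_commute\<close> exchanges them.\<close>
  have E_sol: "diffusion_solution p W r u\<^sub>0 (\<lambda>t. E t u\<^sub>0)" for r
    unfolding diffusion_solution_def
    using E.orbit_C1[OF E(2) u0, of r] E.generator_commute[OF E(2) _ u0] E.zero[OF u0] by auto
  have unique: "ae_eq (u t) (v t)"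
    if u: "diffusion_solution p W r u\<^sub>0 u" and v: "diffusion_solution p W r u\<^sub>0 v" and t: "t \<in> {0..r}" for u v r t
  proof -
    have *: "\<exists>w'. Lp_has_derivative_on p {0..r} w w' \<and> (\<forall>t\<in>{0..r}. ae_eq (w' t) (\<lambda>x. markov (w t) x - w t x))"
      if w: "diffusion_solution p W r u\<^sub>0 w" for w
    proof -
      obtain w' where w': "Lp_has_derivative_on p {0..r} w w'" "\<forall>t\<in>{0..r}. ae_eq (w' t) (?A (w t))"
        using w by (auto simp: diffusion_solution_def Lp_C1_on_def)
      moreover have "ae_eq (w' t) (\<lambda>x. markov (w t) x - w t x)" if "t \<in> {0..r}" for t
      proof -
        have "w t \<in> Lp p" using w'(1) that by (simp add: Lp_has_derivative_on_def)
        from ae_eq_trans[OF w'(2)[rule_format, OF that] ae_eq_sym[OF A[OF this]]] show ?thesis .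
      qed
      ultimately show ?thesis by blast
    qed
    have "ae_eq (u 0) (v 0)"
      using u v by (auto simp: diffusion_solution_def intro: ae_eq_trans ae_eq_sym)
    with *[OF u] *[OF v] t show ?thesis using solution_unique by blast
  qed
  \<comment> \<open>Both orbits solve the equation on {0..t}, so uniqueness compares them at the
    right end point.\<close>
  have heat_E: "ae_eq (heat t u\<^sub>0) (E t u\<^sub>0)" if t: "0 \<le> t" for t
  proof -
    interpret H: Lp_semigroup p heat by unfold_locales (rule p, rule heat_semigroup)
    have "diffusion_solution p W t u\<^sub>0 (\<lambda>t. heat t u\<^sub>0)"
      unfolding diffusion_solution_def
      using H.orbit_C1[OF heat_generated_by[OF A] u0, of t]
        H.generator_commute[OF heat_generated_by[OF A] _ u0] H.zero[OF u0] by auto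
    from unique[OF this E_sol] t show ?thesis by simp
  qed
  have "Lp_norm p (E t u\<^sub>0) \<le> Lp_norm p u\<^sub>0" if t: "0 \<le> t" for t
    using Lp_cball_ae_eq[OF p heat_cball[OF t Lp_cball_norm[OF u0]] heat_E[OF t]] by (rule Lp_cballD)
  then show ?thesis
    using E E_sol unique unfolding E_def by blast
qed

end
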